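(* Let $X$ and $Y$ be cellular spaces with $X$ compact and let $r\ge0$. Let maps $a,b,\tilde a,\tilde b\colon X\to Y$ satisfy $\tilde a\simeq a$, $a\overset{r}{\approx}b$, and $b\simeq\tilde b$ (where $\simeq$ is based homotopy). Then $\tilde a\overset{r}{\approx}\tilde b$.
   Context: Cellular space = based CW complex; maps are based. For a set $W$, $\langle W\rangle$ is the free abelian group on $W$ (basis $\langle w\rangle$). For $X$ compact Hausdorff, $Y^X$ is the space of based maps (compact-open topology), based at the constant map; $Y^X_a$ is the path component of $a$. Restriction homomorphisms are denoted $V\mapsto V|_R$. $\mathcal F_n(X)$ is the set of finite $R\subseteq X$ containing the basepoint with $|R|\le n+1$; $\langle Y^X\rangle^{(s)}=\{V\in\langle Y^X\rangle: V|_R=0$ in $\langle Y^R\rangle$ for all $R\in\mathcal F_{s-1}(X)\}$. For unbased spaces $U,V$, $V^{(U)}$ is the space of unbased maps $U\to V$, $\Xi^U(v)$ the constant map at $v$; for $U=\coprod_iU_i$, the combining product $\boxed{\sqcup}$ is the $\mathbb Z$-multilinear map with $\boxed{\sqcup}_i\langle w_i\rangle=\langle w\rangle$, $w|_{U_i}=w_i$. For a nonempty finite set $E$, $\Delta E$ is its simplex with faces $\Delta F$ ($\emptyset\ne F\subseteq E$); a layout is a set $A$ of pairwise disjoint nonempty subsets of $E$, $\Delta[A]=\coprod_{F\in A}\Delta F$; $S\in\langle V^{(\Delta E)}\rangle$ is fissile if $S|_{\Delta[A]}=\boxed{\sqcup}_{F\in A}S|_{\Delta F}$ for all layouts $A$.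 With $x_0$ the basepoint of $X$, $U\wr X=(U\times X)/(U\times\{x_0\})$, $\#^X\colon(Y^X)^{(U)}\to Y^{U\wr X}$, $\#^X(w)(u\wr x)=w(u)(x)$, and $\langle (Y^X)^{(U)}\rangle^{(s)}_X=\langle\#^X\rangle^{-1}(\langle Y^{U\wr X}\rangle^{(s)})$. Strong $r$-similarity $a\overset{r}{\approx}b$: for each nonempty finite $E$ there exists a fissile $S\in\langle (Y^X_a)^{(\Delta E)}\rangle$ with $\langle\Xi^{\Delta E}(b)\rangle-S\in\langle (Y^X)^{(\Delta E)}\rangle^{(r+1)}_X$. *)

theory Defs
  imports "HOL-Analysis.Analysis" "HOL-Library.Poly_Mapping" "HOL-Library.FuncSet"
begin

definition free_ab :: "'w set \<Rightarrow> ('w \<Rightarrow>\<^sub>0 int) set" where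
  "free_ab W = {V. Poly_Mapping.keys V \<subseteq> W}"

definition lin :: "('a \<Rightarrow> 'b) \<Rightarrow> ('a \<Rightarrow>\<^sub>0 int) \<Rightarrow> ('b \<Rightarrow>\<^sub>0 int)" where
  "lin \<phi> V = frag_extend (\<lambda>w. frag_of (\<phi> w)) V"

definition disc :: "nat \<Rightarrow> (nat \<Rightarrow> real) set" where
  "disc n = {v. (\<forall>i\<ge>n. v i = 0) \<and> (\<Sum>i<n. (v i)\<^sup>2) \<le> 1}"

definition disc_bd :: "nat \<Rightarrow> (nat \<Rightarrow> real) set" where
  "disc_bd n = {v \<in> disc n. (\<Sum>i<n. (v i)\<^sup>2) = 1}"

definition disc_top :: "nat \<Rightarrow> (nat \<Rightarrow> real) topology" where
  "disc_top n = subtopology (powertop_real UNIV) (disc n)"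

definition cw_complex_with :: "'a topology \<Rightarrow> 'a set set \<Rightarrow> ('a set \<Rightarrow> nat) \<Rightarrow> bool" where
  "cw_complex_with X C cdim \<longleftrightarrow>
     Hausdorff_space X \<and>
     (\<forall>c\<in>C. c \<noteq> {}) \<and> pairwise disjnt C \<and> \<Union>C = topspace X \<and>
     (\<forall>c\<in>C. \<exists>\<Phi>. continuous_map (disc_top (cdim c)) X \<Phi> \<and>
        homeomorphic_map (subtopology (disc_top (cdim c)) (disc (cdim c) - disc_bd (cdim c)))
                         (subtopology X c) \<Phi> \<and>
        (\<exists>D. finite D \<and> D \<subseteq> C \<and> (\<forall>d\<in>D. cdim d < cdim c) \<and> \<Phi> ` disc_bd (cdim c) \<subseteq> \<Union>D)) \<and>
     (\<forall>A. A \<subseteq> topspace X \<longrightarrow> (\<forall>c\<in>C. closedin X (A \<inter> X closure_of c)) \<longrightarrow> closedin X A)"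

definition cellular :: "'a topology \<Rightarrow> 'a \<Rightarrow> bool" where
  "cellular X x0 \<longleftrightarrow> (\<exists>C cdim. cw_complex_with X C cdim \<and> {x0} \<in> C \<and> cdim {x0} = 0)"

definition based_maps :: "'x topology \<Rightarrow> 'x \<Rightarrow> 'y topology \<Rightarrow> 'y \<Rightarrow> ('x \<Rightarrow> 'y) set" where
  "based_maps X x0 Y y0 =
     {f. continuous_map X Y f \<and> f x0 = y0 \<and> f \<in> extensional (topspace X)}"

definition co_top :: "'x topology \<Rightarrow> 'x \<Rightarrow> 'y topology \<Rightarrow> 'y \<Rightarrow> ('x \<Rightarrow> 'y) topology" where
  "co_top X x0 Y y0 =
     subtopology
       (topology_generated_by {{f. f ` K \<subseteq> U} | K U. compactin X K \<and> openin Y U})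
       (based_maps X x0 Y y0)"

definition based_homotopic :: "'x topology \<Rightarrow> 'x \<Rightarrow> 'y topology \<Rightarrow> 'y \<Rightarrow> ('x \<Rightarrow> 'y) \<Rightarrow> ('x \<Rightarrow> 'y) \<Rightarrow> bool" where
  "based_homotopic X x0 Y y0 f g \<longleftrightarrow> homotopic_with (\<lambda>h. h x0 = y0) X Y f g"

definition umaps :: "'u topology \<Rightarrow> 'v topology \<Rightarrow> ('u \<Rightarrow> 'v) set" where
  "umaps U V = {w. continuous_map U V w \<and> w \<in> extensional (topspace U)}"

text \<open>Elements V with V|_R = 0 for all finite R \<subseteq> P containing the basepoint p0 with
  card R \<le> s (i.e. R \<in> F_{s-1}).\<close>
definition filt :: "'p set \<Rightarrow> 'p \<Rightarrow> nat \<Rightarrow> (('p \<Rightarrow> 'y) \<Rightarrow>\<^sub>0 int) set" where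
  "filt P p0 s = {V. \<forall>R. finite R \<and> R \<subseteq> P \<and> p0 \<in> R \<and> card R \<le> s \<longrightarrow>
                        lin (\<lambda>f. restrict f R) V = 0}"

definition dsimplex :: "nat set \<Rightarrow> (nat \<Rightarrow> real) set" where
  "dsimplex E = {t. (\<forall>e. 0 \<le> t e) \<and> (\<forall>e. e \<notin> E \<longrightarrow> t e = 0) \<and> sum t E = 1}"

definition dsimplex_top :: "nat set \<Rightarrow> (nat \<Rightarrow> real) topology" where
  "dsimplex_top E = subtopology (powertop_real UNIV) (dsimplex E)"

definition layout :: "nat set \<Rightarrow> nat set set \<Rightarrow> bool" where
  "layout E A \<longleftrightarrow> (\<forall>F\<in>A. F \<noteq> {} \<and> F \<subseteq> E) \<and> pairwise disjnt A"

text \<open>Delta[A], realised as the union of the (pairwise disjoint) faces inside Delta E.\<close>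
definition layout_space :: "nat set set \<Rightarrow> (nat \<Rightarrow> real) set" where
  "layout_space A = (\<Union>F\<in>A. dsimplex F)"

definition glue :: "nat set set \<Rightarrow> (nat set \<Rightarrow> (nat \<Rightarrow> real) \<Rightarrow> 'v) \<Rightarrow> (nat \<Rightarrow> real) \<Rightarrow> 'v" where
  "glue A \<sigma> = (\<lambda>t. if \<exists>F\<in>A. t \<in> dsimplex F
                     then \<sigma> (THE F. F \<in> A \<and> t \<in> dsimplex F) t else undefined)"

text \<open>The combining product: the multilinear map sending (frag_of w_F)_F to frag_of of
  the glued map.\<close>
definition combine :: "nat set set \<Rightarrow> (nat set \<Rightarrow> ((nat \<Rightarrow> real) \<Rightarrow> 'v) \<Rightarrow>\<^sub>0 int)
                        \<Rightarrow> ((nat \<Rightarrow> real) \<Rightarrow> 'v) \<Rightarrow>\<^sub>0 int" where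
  "combine A S = (\<Sum>\<sigma> \<in> Pi\<^sub>E A (\<lambda>F. Poly_Mapping.keys (S F)).
       frag_cmul (\<Prod>F\<in>A. Poly_Mapping.lookup (S F) (\<sigma> F)) (frag_of (glue A \<sigma>)))"

definition fissile :: "nat set \<Rightarrow> (((nat \<Rightarrow> real) \<Rightarrow> 'v) \<Rightarrow>\<^sub>0 int) \<Rightarrow> bool" where
  "fissile E S \<longleftrightarrow> (\<forall>A. layout E A \<longrightarrow>
      lin (\<lambda>w. restrict w (layout_space A)) S
        = combine A (\<lambda>F. lin (\<lambda>w. restrict w (dsimplex F)) S))"

text \<open>Points of U \<wr> X = (U \<times> X)/(U \<times> {x0}): None is the collapsed basepoint,
  Some (u,x) with x \<noteq> x0 the other points.\<close>
definition wr_points :: "'u set \<Rightarrow> 'x topology \<Rightarrow> 'x \<Rightarrow> ('u \<times> 'x) option set" where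
  "wr_points U X x0 = insert None (Some ` (U \<times> (topspace X - {x0})))"

definition sharp :: "'y \<Rightarrow> ('u \<Rightarrow> 'x \<Rightarrow> 'y) \<Rightarrow> ('u \<times> 'x) option \<Rightarrow> 'y" where
  "sharp y0 w = (\<lambda>p. case p of None \<Rightarrow> y0 | Some (u, x) \<Rightarrow> w u x)"

definition wr_filt :: "'u topology \<Rightarrow> 'x topology \<Rightarrow> 'x \<Rightarrow> 'y topology \<Rightarrow> 'y \<Rightarrow> nat
                       \<Rightarrow> (('u \<Rightarrow> 'x \<Rightarrow> 'y) \<Rightarrow>\<^sub>0 int) set" where
  "wr_filt U X x0 Y y0 s =
     {V \<in> free_ab (umaps U (co_top X x0 Y y0)).
        lin (sharp y0) V \<in> filt (wr_points (topspace U) X x0) None s}"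

definition strongly_similar ::
  "'x topology \<Rightarrow> 'x \<Rightarrow> 'y topology \<Rightarrow> 'y \<Rightarrow> nat \<Rightarrow> ('x \<Rightarrow> 'y) \<Rightarrow> ('x \<Rightarrow> 'y) \<Rightarrow> bool" where
  "strongly_similar X x0 Y y0 r a b \<longleftrightarrow>
     (\<forall>E. finite E \<and> E \<noteq> {} \<longrightarrow>
        (\<exists>S. S \<in> free_ab (umaps (dsimplex_top E)
                   (subtopology (co_top X x0 Y y0)
                      (path_component_of_set (co_top X x0 Y y0) a))) \<and>
             fissile E S \<and>
             frag_of (restrict (\<lambda>_. b) (dsimplex E)) - S
               \<in> wr_filt (dsimplex_top E) X x0 Y y0 (r + 1)))"

end

theory Submission
  imports Defs
begin

text \<open>
  Strong similarity depends only on the path component of \<open>a\<close>, so replacing \<open>a\<close> by a homotopic map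
  is harmless. For \<open>b \<simeq> b'\<close> we look for a homotopy \<open>\<Theta>\<^sub>t(x, y)\<close> with \<open>\<Theta>\<^sub>0(x, y) = y\<close>,
  \<open>\<Theta>\<^sub>1(x, b x) = b' x\<close> and \<open>\<Theta>\<^sub>t(x\<^sub>0, y\<^sub>0) = y\<^sub>0\<close>. Acting on a map \<open>f\<close> pointwise by
  \<open>x \<mapsto> \<Theta>\<^sub>1(x, f x)\<close>, it sends \<open>b\<close> to \<open>b'\<close>, preserves path components, and commutes with restriction
  and gluing; hence it carries a fissile witness for \<open>b\<close> to one for \<open>b'\<close>.

  Only finitely many maps occur in a witness, so \<open>Y\<close> may be replaced by a finite subcomplex \<open>L\<close>.
  Such an \<open>L\<close> is locally equiconnected in a weak sense: near the diagonal, the two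
  projections of \<open>L \<times> L\<close> are homotopic. This is proved by attaching one cell at a time. Then \<open>\<Theta>\<close>
  moves a point \<open>y\<close> near \<open>b x\<close> first to \<open>b x\<close> and then along the homotopy from \<open>b\<close> to \<open>b'\<close>, the
  elapsed time being controlled by a Urysohn function that is 1 on the graph of \<open>b\<close>.
\<close>

section \<open>Free abelian groups and the combining product\<close>

lemma lin_lin: "lin \<phi> (lin \<psi> V) = lin (\<lambda>w. \<phi> (\<psi> w)) V"
  using frag_extend_compose[of "\<lambda>w. frag_of (\<phi> w)" \<psi> V] by (simp add: lin_def o_def)

lemma lin_diff: "lin \<phi> (V - W) = lin \<phi> V - lin \<phi> W"
  by (simp add: lin_def frag_extend_diff)

lemma lin_frag_of [simp]: "lin \<phi> (frag_of w) = frag_of (\<phi> w)"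
  by (simp add: lin_def)

lemma lin_zero [simp]: "lin \<phi> 0 = 0"
  by (simp add: lin_def)

lemma lin_cong: "(\<And>w. w \<in> Poly_Mapping.keys V \<Longrightarrow> \<phi> w = \<psi> w) \<Longrightarrow> lin \<phi> V = lin \<psi> V"
  unfolding lin_def by (rule frag_extend_eq) simp

lemma keys_lin: "Poly_Mapping.keys (lin \<phi> V) \<subseteq> \<phi> ` Poly_Mapping.keys V"
  unfolding lin_def using keys_frag_extend[of "\<lambda>w. frag_of (\<phi> w)" V] by auto

lemma lookup_lin:
  "Poly_Mapping.lookup (lin \<phi> V) w
     = (\<Sum>k\<in>{k \<in> Poly_Mapping.keys V. \<phi> k = w}. Poly_Mapping.lookup V k)"
proof -
  have "Poly_Mapping.lookup (lin \<phi> V) w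
      = (\<Sum>k\<in>Poly_Mapping.keys V. if \<phi> k = w then Poly_Mapping.lookup V k else 0)"
    unfolding lin_def frag_extend_def lookup_sum
    by (rule sum.cong) auto
  then show ?thesis
    by (simp add: sum.inter_filter)
qed

lemma frag_cmul_sum_left: "frag_cmul (sum c I) V = (\<Sum>i\<in>I. frag_cmul (c i) V)"
  by (induction I rule: infinite_finite_induct) (auto simp: frag_cmul_distrib)

text \<open>\<open>lin\<close> can cancel basis elements, so the keys of a pushforward are only
  known to lie in an image set. Enlarging the index sets is harmless, since every extra term has a
  vanishing factor in its coefficient.\<close>

lemma combine_superset:
  assumes "finite A" "\<And>F. F \<in> A \<Longrightarrow> finite (B F)"
    and "\<And>F. F \<in> A \<Longrightarrow> Poly_Mapping.keys (S F) \<subseteq> B F"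
  shows "combine A S = (\<Sum>\<sigma> \<in> Pi\<^sub>E A B.
       frag_cmul (\<Prod>F\<in>A. Poly_Mapping.lookup (S F) (\<sigma> F)) (frag_of (glue A \<sigma>)))"
  unfolding combine_def
proof (rule sum.mono_neutral_left)
  show "finite (Pi\<^sub>E A B)"
    using assms by (intro finite_PiE) auto
  show "(\<Pi>\<^sub>E F\<in>A. Poly_Mapping.keys (S F)) \<subseteq> Pi\<^sub>E A B"
    using assms(3) by (rule PiE_mono)
  have "(\<Prod>F\<in>A. Poly_Mapping.lookup (S F) (\<sigma> F)) = 0"
    if "\<sigma> \<in> Pi\<^sub>E A B - (\<Pi>\<^sub>E F\<in>A. Poly_Mapping.keys (S F))" for \<sigma>
  proof -
    have "\<exists>F\<in>A. \<sigma> F \<notin> Poly_Mapping.keys (S F)"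
      using that by (auto simp: PiE_iff)
    then obtain F where "F \<in> A" "\<sigma> F \<notin> Poly_Mapping.keys (S F)" ..
    then have "Poly_Mapping.lookup (S F) (\<sigma> F) = 0"
      by (simp add: in_keys_iff)
    then show ?thesis
      using \<open>F \<in> A\<close> \<open>finite A\<close> by (meson prod_zero)
  qed
  then show "\<forall>\<sigma>\<in>Pi\<^sub>E A B - (\<Pi>\<^sub>E F\<in>A. Poly_Mapping.keys (S F)).
      frag_cmul (\<Prod>F\<in>A. Poly_Mapping.lookup (S F) (\<sigma> F)) (frag_of (glue A \<sigma>)) = 0"
    by simp
qed

lemma combine_cong:
  assumes "\<And>F. F \<in> A \<Longrightarrow> S F = S' F"
  shows "combine A S = combine A S'"
proof -
  have "(\<Pi>\<^sub>E F\<in>A. Poly_Mapping.keys (S F)) = (\<Pi>\<^sub>E F\<in>A. Poly_Mapping.keys (S' F))"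
    by (rule PiE_cong) (simp add: assms)
  moreover have "(\<Prod>F\<in>A. Poly_Mapping.lookup (S F) (\<sigma> F)) = (\<Prod>F\<in>A. Poly_Mapping.lookup (S' F) (\<sigma> F))" for \<sigma>
    by (rule prod.cong) (simp_all add: assms)
  ultimately show ?thesis
    by (simp add: combine_def)
qed

text \<open>A coefficient of \<open>lin\<close> is a sum over a fibre, and a product of such sums
  expands over the product of the fibres, which is a fibre of \<open>push\<close>. Grouping by
  \<open>push\<close> accounts for keys that are merged or cancelled.\<close>

lemma combine_lin:
  assumes "finite A"
  shows "combine A (\<lambda>F. lin (\<phi> F) (S F))
    = (\<Sum>\<sigma> \<in> Pi\<^sub>E A (\<lambda>F. Poly_Mapping.keys (S F)).
        frag_cmul (\<Prod>F\<in>A. Poly_Mapping.lookup (S F) (\<sigma> F))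
          (frag_of (glue A (restrict (\<lambda>F. \<phi> F (\<sigma> F)) A))))"
proof -
  define K where "K = (\<lambda>F. Poly_Mapping.keys (S F))"
  define push where "push = (\<lambda>\<sigma>. restrict (\<lambda>F. \<phi> F (\<sigma> F)) A)"
  define coef where "coef = (\<lambda>\<sigma>. \<Prod>F\<in>A. Poly_Mapping.lookup (S F) (\<sigma> F))"
  let ?B = "\<lambda>F. \<phi> F ` K F"
  have fin: "finite (Pi\<^sub>E A K)" "finite (Pi\<^sub>E A ?B)"
    using assms by (auto simp: K_def intro!: finite_PiE)
  have fibre: "Pi\<^sub>E A (\<lambda>F. {k \<in> K F. \<phi> F k = \<tau> F}) = {\<sigma> \<in> Pi\<^sub>E A K. push \<sigma> = \<tau>}"
    if "\<tau> \<in> Pi\<^sub>E A ?B" for \<tau>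
    using that by (fastforce simp: push_def PiE_iff extensional_def fun_eq_iff)
  have "combine A (\<lambda>F. lin (\<phi> F) (S F)) = (\<Sum>\<tau> \<in> Pi\<^sub>E A ?B.
       frag_cmul (\<Prod>F\<in>A. Poly_Mapping.lookup (lin (\<phi> F) (S F)) (\<tau> F)) (frag_of (glue A \<tau>)))"
    using assms unfolding K_def by (intro combine_superset keys_lin) auto
  also have "\<dots> = (\<Sum>\<tau> \<in> Pi\<^sub>E A ?B. \<Sum>\<sigma>\<in>{\<sigma> \<in> Pi\<^sub>E A K. push \<sigma> = \<tau>}.
       frag_cmul (coef \<sigma>) (frag_of (glue A (push \<sigma>))))"
  proof (rule sum.cong)
    fix \<tau> assume \<tau>: "\<tau> \<in> Pi\<^sub>E A ?B"
    have "(\<Prod>F\<in>A. Poly_Mapping.lookup (lin (\<phi> F) (S F)) (\<tau> F))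
        = (\<Sum>\<sigma>\<in>{\<sigma> \<in> Pi\<^sub>E A K. push \<sigma> = \<tau>}. coef \<sigma>)"
      unfolding lookup_lin fibre[OF \<tau>, symmetric] coef_def unfolding K_def
      by (rule prod_sum_PiE) (use assms in auto)
    then show "frag_cmul (\<Prod>F\<in>A. Poly_Mapping.lookup (lin (\<phi> F) (S F)) (\<tau> F)) (frag_of (glue A \<tau>))
        = (\<Sum>\<sigma>\<in>{\<sigma> \<in> Pi\<^sub>E A K. push \<sigma> = \<tau>}. frag_cmul (coef \<sigma>) (frag_of (glue A (push \<sigma>))))"
      by (simp add: frag_cmul_sum_left)
  qed simp
  also have "\<dots> = (\<Sum>\<sigma>\<in>Pi\<^sub>E A K. frag_cmul (coef \<sigma>) (frag_of (glue A (push \<sigma>))))"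
    by (rule sum.group) (use fin in \<open>auto simp: push_def\<close>)
  finally show ?thesis
    by (simp add: K_def push_def coef_def)
qed

section \<open>Faces of a simplex and gluing over a layout\<close>

lemma dsimplex_disjoint:
  assumes "disjnt F G" "t \<in> dsimplex F" "t \<in> dsimplex G"
  shows False
proof -
  have "t e = 0" if "e \<in> F" for e
    using assms that by (auto simp: dsimplex_def disjnt_iff)
  then have "sum t F = 0"
    by simp
  then show False
    using assms(2) by (simp add: dsimplex_def)
qed

lemma dsimplex_mono:
  assumes "finite E" "F \<subseteq> E"
  shows "dsimplex F \<subseteq> dsimplex E"
proof
  fix t assume t: "t \<in> dsimplex F"
  then have "sum t E = sum t F"
    using assms by (intro sum.mono_neutral_right) (auto simp: dsimplex_def)
  then show "t \<in> dsimplex E"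
    using t assms(2) by (auto simp: dsimplex_def)
qed

lemma glue_eq:
  assumes "layout E A" "F \<in> A" "t \<in> dsimplex F"
  shows "glue A \<sigma> t = \<sigma> F t"
proof -
  have "(THE F. F \<in> A \<and> t \<in> dsimplex F) = F"
    using assms dsimplex_disjoint unfolding layout_def pairwise_def by (intro the_equality) blast+
  then show ?thesis
    using assms by (auto simp: glue_def)
qed

text \<open>Postcomposition changes values only, so it commutes with restriction and with gluing;
  \<open>combine_lin\<close> then carries it through the combining product.\<close>

lemma fissile_postcompose:
  assumes "finite E" "fissile E S"
  shows "fissile E (lin (\<lambda>w. restrict (\<lambda>u. \<tau> (w u)) (dsimplex E)) S)"
  unfolding fissile_def
proof (intro allI impI)
  fix A assume A: "layout E A"
  then have "A \<subseteq> Pow E"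
    by (auto simp: layout_def)
  then have "finite A"
    using \<open>finite E\<close> by (meson finite_Pow_iff finite_subset)
  \<comment> \<open>The domain is a parameter because the same operation is needed on the whole
    simplex, on its faces and on the layout space.\<close>
  define post :: "(nat \<Rightarrow> real) set \<Rightarrow> ((nat \<Rightarrow> real) \<Rightarrow> 'a) \<Rightarrow> (nat \<Rightarrow> real) \<Rightarrow> 'b"
    where "post = (\<lambda>D w. restrict (\<lambda>u. \<tau> (w u)) D)"
  have sub: "dsimplex F \<subseteq> dsimplex E" if "F \<in> A" for F
    using that \<open>A \<subseteq> Pow E\<close> dsimplex_mono[OF \<open>finite E\<close>] by blast
  have sub': "layout_space A \<subseteq> dsimplex E"
    using sub by (auto simp: layout_space_def)
  have restr: "lin (\<lambda>w. restrict w D) (lin (post (dsimplex E)) S) = lin (post D) (lin (\<lambda>w. restrict w D) S)"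
    if "D \<subseteq> dsimplex E" for D
    unfolding lin_lin using that by (intro lin_cong) (auto simp: post_def fun_eq_iff)
  have glue: "post (layout_space A) (glue A \<sigma>) = glue A (restrict (\<lambda>F. post (dsimplex F) (\<sigma> F)) A)" for \<sigma>
  proof
    fix t
    show "post (layout_space A) (glue A \<sigma>) t = glue A (restrict (\<lambda>F. post (dsimplex F) (\<sigma> F)) A) t"
    proof (cases "\<exists>F\<in>A. t \<in> dsimplex F")
      case True
      then obtain F where F: "F \<in> A" "t \<in> dsimplex F" by blast
      then have "t \<in> layout_space A"
        by (auto simp: layout_space_def)
      then show ?thesis
        using F by (simp add: post_def glue_eq[OF A F])
    next
      case False
      then show ?thesis
        by (auto simp: post_def layout_space_def glue_def)
    qed
  qed
  let ?S = "\<lambda>F. lin (\<lambda>w. restrict w (dsimplex F)) S"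
  have "lin (\<lambda>w. restrict w (layout_space A)) (lin (post (dsimplex E)) S)
      = lin (post (layout_space A)) (combine A ?S)"
    using restr[OF sub'] assms(2) A by (simp add: fissile_def)
  also have "\<dots> = (\<Sum>\<sigma> \<in> Pi\<^sub>E A (\<lambda>F. Poly_Mapping.keys (?S F)).
        frag_cmul (\<Prod>F\<in>A. Poly_Mapping.lookup (?S F) (\<sigma> F))
          (frag_of (glue A (restrict (\<lambda>F. post (dsimplex F) (\<sigma> F)) A))))"
    unfolding combine_def lin_def
    using \<open>finite A\<close> by (subst frag_extend_sum) (auto simp: frag_extend_cmul glue intro!: finite_PiE)
  also have "\<dots> = combine A (\<lambda>F. lin (post (dsimplex F)) (?S F))"
    using combine_lin[OF \<open>finite A\<close>, of "\<lambda>F. post (dsimplex F)" ?S] by simp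
  also have "\<dots> = combine A (\<lambda>F. lin (\<lambda>w. restrict w (dsimplex F)) (lin (post (dsimplex E)) S))"
    by (rule combine_cong) (simp add: restr sub)
  finally show "lin (\<lambda>w. restrict w (layout_space A)) (lin (\<lambda>w. restrict (\<lambda>u. \<tau> (w u)) (dsimplex E)) S)
      = combine A (\<lambda>F. lin (\<lambda>w. restrict w (dsimplex F)) (lin (\<lambda>w. restrict (\<lambda>u. \<tau> (w u)) (dsimplex E)) S))"
    by (simp add: post_def)
qed

text \<open>The new value at \<open>(u, x)\<close> depends only on \<open>x\<close> and the old
  value there. Hence the restriction of the new element to \<open>R\<close> is the image under a
  linear map of the restriction of the old one, which is 0.\<close>

lemma filt_postcompose:
  assumes V: "lin (sharp y0) V \<in> filt (wr_points U X x0) None s"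
  shows "lin (sharp y0) (lin (\<lambda>w. restrict (\<lambda>u. restrict (\<lambda>x. \<theta> x (w u x)) (topspace X)) U) V)
          \<in> filt (wr_points U X x0) None s"
  unfolding filt_def
proof (clarify, goal_cases)
  case (1 R)
  \<comment> \<open>At the collapsed basepoint \<open>sharp\<close> takes the value
    \<open>y0\<close> whatever the map, hence the constant branch.\<close>
  define post where "post = (\<lambda>g. restrict (\<lambda>p. case p of None \<Rightarrow> y0 | Some (u, x) \<Rightarrow> \<theta> x (g p)) R)"
  have "lin (\<lambda>f. restrict f R) (lin (sharp y0) (lin (\<lambda>w. restrict (\<lambda>u. restrict (\<lambda>x. \<theta> x (w u x)) (topspace X)) U) V))
      = lin post (lin (\<lambda>f. restrict f R) (lin (sharp y0) V))"
    unfolding lin_lin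
  proof (rule lin_cong, rule ext)
    fix w p
    show "restrict (sharp y0 (restrict (\<lambda>u. restrict (\<lambda>x. \<theta> x (w u x)) (topspace X)) U)) R p
        = post (restrict (sharp y0 w) R) p"
      using \<open>R \<subseteq> wr_points U X x0\<close>
      by (auto simp: post_def sharp_def wr_points_def restrict_def split: option.split)
  qed
  also have "\<dots> = 0"
    using V 1 by (auto simp: filt_def)
  finally show ?case by simp
qed

section \<open>The compact-open topology\<close>

lemma topspace_co_top [simp]: "topspace (co_top X x0 Y y0) = based_maps X x0 Y y0"
proof -
  \<comment> \<open>The generator with \<open>K = U = {}\<close> contains every function, so the
    subbasis covers the whole type.\<close>
  have "{f::'a \<Rightarrow> 'b. f ` {} \<subseteq> {}} \<in> {{f. f ` K \<subseteq> U} | K U. compactin X K \<and> openin Y U}"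
    by blast
  then have "\<Union>{{f. f ` K \<subseteq> U} | K U. compactin X K \<and> openin Y U} = (UNIV :: ('a \<Rightarrow> 'b) set)"
    by auto
  then show ?thesis
    by (simp add: co_top_def topology_generated_by_topspace)
qed

text \<open>If \<open>{z} \<times> K\<close> lies in an open set, the tube lemma for the compact
  \<open>K\<close> thickens it to a neighbourhood of \<open>z\<close>; this is openness of the
  preimage of a subbasic set.\<close>

lemma continuous_map_co_top_curry:
  assumes G: "continuous_map (prod_topology Z X) Y (\<lambda>(z, x). G z x)"
    and x0: "x0 \<in> topspace X" "\<And>z. z \<in> topspace Z \<Longrightarrow> G z x0 = y0"
  shows "continuous_map Z (co_top X x0 Y y0) (\<lambda>z. restrict (G z) (topspace X))"
  unfolding co_top_def continuous_map_in_subtopology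
proof (intro conjI continuous_on_generated_topo)
  fix B assume "B \<in> {{f::'b \<Rightarrow> 'c. f ` K \<subseteq> U} | K U. compactin X K \<and> openin Y U}"
  then obtain K U where B: "B = {f. f ` K \<subseteq> U}" and K: "compactin X K" and U: "openin Y U"
    by blast
  define W where "W = {p \<in> topspace (prod_topology Z X). (case p of (z, x) \<Rightarrow> G z x) \<in> U}"
  have W: "openin (prod_topology Z X) W"
    unfolding W_def using G U by (rule openin_continuous_map_preimage)
  have KX: "K \<subseteq> topspace X"
    using K by (rule compactin_subset_topspace)
  let ?N = "(\<lambda>z. restrict (G z) (topspace X)) -` B \<inter> topspace Z"
  have N: "z \<in> ?N \<longleftrightarrow> z \<in> topspace Z \<and> {z} \<times> K \<subseteq> W" for z
    using KX by (auto simp: B W_def image_subset_iff restrict_def)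
  show "openin Z ?N"
  proof (subst openin_subopen, intro ballI)
    fix z assume "z \<in> ?N"
    then obtain A C where AC: "openin Z A" "openin X C" "z \<in> A" "K \<subseteq> C" "A \<times> C \<subseteq> W"
      using tube_lemma_right[OF W K, of z] N by auto
    moreover have "A \<subseteq> ?N"
      unfolding subset_iff N using AC openin_subset[OF AC(1)] by auto
    ultimately show "\<exists>T. openin Z T \<and> z \<in> T \<and> T \<subseteq> ?N"
      by blast
  qed
next
  have "(UNIV :: ('b \<Rightarrow> 'c) set) = {f. f ` {} \<subseteq> {}}"
    by auto
  then show "(\<lambda>z. restrict (G z) (topspace X)) ` topspace Z
      \<subseteq> \<Union>{{f::'b \<Rightarrow> 'c. f ` K \<subseteq> U} | K U. compactin X K \<and> openin Y U}"
    by blast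
  have "continuous_map X Y (restrict (G z) (topspace X))" if "z \<in> topspace Z" for z
  proof -
    have "continuous_map X (prod_topology Z X) (\<lambda>x. (z, x))"
      using that by (intro continuous_intros) auto
    from continuous_map_compose[OF this G] show ?thesis
      by (rule continuous_map_eq) auto
  qed
  then show "(\<lambda>z. restrict (G z) (topspace X)) \<in> topspace Z \<rightarrow> based_maps X x0 Y y0"
    using x0 by (auto simp: based_maps_def)
qed

text \<open>The other half of the exponential law. By regularity a point \<open>x\<close> has a
  closed neighbourhood \<open>K\<close> inside the preimage of \<open>U\<close> under
  \<open>w z\<close>. As \<open>X\<close> is compact, so is \<open>K\<close>, and the subbasic set
  for \<open>K\<close> and \<open>U\<close> supplies the neighbourhood of \<open>z\<close>.\<close>

lemma continuous_map_co_top_uncurry: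
  assumes X: "compact_space X" "Hausdorff_space X"
    and w: "continuous_map Z (co_top X x0 Y y0) w"
  shows "continuous_map (prod_topology Z X) Y (\<lambda>(z, x). w z x)"
proof -
  have cw: "continuous_map X Y (w z)" if "z \<in> topspace Z" for z
    using continuous_map_image_subset_topspace[OF w] that by (auto simp: based_maps_def)
  have w': "continuous_map Z (topology_generated_by {{f. f ` K \<subseteq> U} | K U. compactin X K \<and> openin Y U}) w"
    using w unfolding co_top_def by (rule continuous_map_into_fulltopology)
  have reg: "neighbourhood_base_of (closedin X) X"
    using compact_Hausdorff_imp_regular_space[OF X] by (simp add: neighbourhood_base_of_closedin)
  have "openin (prod_topology Z X) {p \<in> topspace (prod_topology Z X). (case p of (z, x) \<Rightarrow> w z x) \<in> U}"
    (is "openin _ ?W") if U: "openin Y U" for U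
    unfolding openin_prod_topology_alt
  proof (intro allI impI)
    fix z x assume zx: "(z, x) \<in> ?W"
    then have "openin X {x \<in> topspace X. w z x \<in> U}"
      using openin_continuous_map_preimage[OF cw U] by simp
    then obtain N K where NK: "openin X N" "closedin X K" "x \<in> N" "N \<subseteq> K" "K \<subseteq> {x \<in> topspace X. w z x \<in> U}"
      using reg zx unfolding neighbourhood_base_of by (smt (verit) case_prod_conv mem_Collect_eq mem_Sigma_iff topspace_prod_topology)
    have "compactin X K"
      using X(1) NK(2) by (rule closedin_compact_space)
    then have "openin Z (w -` {f. f ` K \<subseteq> U} \<inter> topspace Z)"
      using w' U unfolding continuous_on_generated_topo_iff by blast
    moreover have "(w -` {f. f ` K \<subseteq> U} \<inter> topspace Z) \<times> N \<subseteq> ?W"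
      using NK openin_subset[OF NK(1)] by (auto simp: image_subset_iff dest!: subsetD[OF NK(4)])
    moreover have "z \<in> w -` {f. f ` K \<subseteq> U} \<inter> topspace Z"
      using NK zx by auto
    ultimately show "\<exists>A B. openin Z A \<and> openin X B \<and> z \<in> A \<and> x \<in> B \<and> A \<times> B \<subseteq> ?W"
      using NK by blast
  qed
  moreover have "(case p of (z, x) \<Rightarrow> w z x) \<in> topspace Y" if "p \<in> topspace (prod_topology Z X)" for p
    using that continuous_map_image_subset_topspace[OF cw] by auto
  ultimately show ?thesis
    by (auto simp: continuous_map)
qed

lemma path_component_of_set_subset_co_top:
  "path_component_of_set (co_top X x0 Y y0) a \<subseteq> based_maps X x0 Y y0"
  using path_component_of_subset_topspace[of "co_top X x0 Y y0" a] by simp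

lemma path_component_of_co_topI:
  assumes H: "continuous_map (prod_topology (top_of_set {0..1::real}) X) Y (\<lambda>(t, x). H t x)"
    and x0: "x0 \<in> topspace X" "\<And>t. t \<in> {0..1} \<Longrightarrow> H t x0 = y0"
  shows "path_component_of (co_top X x0 Y y0) (restrict (H 0) (topspace X)) (restrict (H 1) (topspace X))"
proof -
  have "pathin (co_top X x0 Y y0) (\<lambda>t. restrict (H t) (topspace X))"
    unfolding pathin_def using continuous_map_co_top_curry[OF H] x0 by simp
  then show ?thesis
    unfolding path_component_of_def by blast
qed

lemma based_homotopic_imp_path_component_of:
  assumes "based_homotopic X x0 Y y0 f g" "x0 \<in> topspace X"
    and fg: "f \<in> based_maps X x0 Y y0" "g \<in> based_maps X x0 Y y0"
  shows "path_component_of (co_top X x0 Y y0) f g"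
proof -
  obtain h where h: "continuous_map (prod_topology (top_of_set {0..1::real}) X) Y h"
    "\<And>x. h (0, x) = f x" "\<And>x. h (1, x) = g x" "\<And>t. t \<in> {0..1} \<Longrightarrow> h (t, x0) = y0"
    using assms(1) unfolding based_homotopic_def homotopic_with_def by auto
  have "restrict f (topspace X) = f" "restrict g (topspace X) = g"
    using fg by (auto simp: based_maps_def extensional_restrict)
  then show ?thesis
    using path_component_of_co_topI[of X Y "\<lambda>t x. h (t, x)" x0 y0] h assms(2) by simp
qed

section \<open>Discs\<close>

lemma continuous_map_compose2:
  assumes "continuous_map (prod_topology A B) C (\<lambda>(a, b). H a b)"
    and "continuous_map W A f" "continuous_map W B g"
  shows "continuous_map W C (\<lambda>w. H (f w) (g w))"
  using continuous_map_compose[OF continuous_map_pairedI[OF assms(2,3)] assms(1)]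
  by (simp add: o_def)

lemma continuous_map_real_compose:
  assumes "continuous_map W euclideanreal f" "continuous_on UNIV k"
  shows "continuous_map W euclideanreal (\<lambda>w. k (f w))"
  using continuous_map_compose[OF assms(1), of euclideanreal k] assms(2) by (simp add: o_def)

text \<open>Homotopies below have the whole real line as time, which makes rescaling easy; clamping
  brings a time back to where the geometric moves are defined.\<close>

definition clamp01 :: "real \<Rightarrow> real" where
  "clamp01 t = max 0 (min 1 t)"

lemma clamp01_simps [simp]:
  "0 \<le> clamp01 t" "clamp01 t \<le> 1" "t \<le> 0 \<Longrightarrow> clamp01 t = 0" "1 \<le> t \<Longrightarrow> clamp01 t = 1"
  "clamp01 0 = 0" "clamp01 1 = 1"
  by (auto simp: clamp01_def)

lemma continuous_map_clamp01:
  assumes "continuous_map W euclideanreal f"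
  shows "continuous_map W euclideanreal (\<lambda>w. clamp01 (f w))"
  using assms unfolding clamp01_def
  by (rule continuous_map_real_compose) (intro continuous_intros)

section \<open>Norm, compactness and motions of the disc\<close>

abbreviation disc_norm :: "nat \<Rightarrow> (nat \<Rightarrow> real) \<Rightarrow> real" where
  "disc_norm n v \<equiv> L2_set v {..<n}"

lemma disc_iff: "v \<in> disc n \<longleftrightarrow> (\<forall>i\<ge>n. v i = 0) \<and> disc_norm n v \<le> 1"
  by (auto simp: disc_def L2_set_def)

lemma disc_bd_iff: "v \<in> disc_bd n \<longleftrightarrow> (\<forall>i\<ge>n. v i = 0) \<and> disc_norm n v = 1"
  by (auto simp: disc_bd_def disc_def L2_set_def)

lemma topspace_disc_top [simp]: "topspace (disc_top n) = disc n"
  by (simp add: disc_top_def)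

lemma continuous_map_disc_top:
  "continuous_map W (disc_top n) f \<longleftrightarrow>
     (\<forall>i. continuous_map W euclideanreal (\<lambda>w. f w i)) \<and> f \<in> topspace W \<rightarrow> disc n"
  by (simp add: disc_top_def continuous_map_in_subtopology continuous_map_componentwise_UNIV)

lemma continuous_map_disc_coordinate:
  "continuous_map (disc_top n) euclideanreal (\<lambda>v. v i)"
  using continuous_map_disc_top[of "disc_top n" n "\<lambda>v. v"] by simp

lemma continuous_map_disc_norm: "continuous_map (disc_top n) euclideanreal (disc_norm n)"
  unfolding L2_set_def
  by (intro continuous_map_sqrt continuous_map_sum continuous_map_real_pow continuous_map_disc_coordinate) auto

lemma disc_component_le:
  assumes "v \<in> disc n"
  shows "\<bar>v i\<bar> \<le> 1"
proof (cases "i < n")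
  case True
  have "(v i)\<^sup>2 \<le> (\<Sum>i<n. (v i)\<^sup>2)"
    using True by (intro member_le_sum) auto
  then show ?thesis
    using assms by (simp add: disc_def abs_square_le_1 [symmetric])
qed (use assms in \<open>auto simp: disc_def\<close>)

text \<open>The disc is cut out by closed conditions inside a product of intervals, which is compact
  by Tychonoff.\<close>

lemma compact_space_disc_top: "compact_space (disc_top n)"
proof -
  let ?Q = "(\<Pi>\<^sub>E i\<in>UNIV. {-1..1::real})"
  have "compactin (powertop_real UNIV) ?Q"
    by (subst compactin_PiE) auto
  moreover have "closedin (powertop_real UNIV) (disc n)"
  proof -
    have coord: "continuous_map (powertop_real UNIV) euclideanreal (\<lambda>v. v i)" for i :: nat
      by (rule continuous_map_product_projection) simp
    have "continuous_map (powertop_real UNIV) euclideanreal (\<lambda>v. \<Sum>i<n. (v i)\<^sup>2)"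
      by (intro continuous_map_sum continuous_map_real_pow coord) auto
    from closedin_continuous_map_preimage[OF this, of "{..1}"]
    have 1: "closedin (powertop_real UNIV) {v. (\<Sum>i<n. (v i)\<^sup>2) \<le> 1}"
      by simp
    have "closedin (powertop_real UNIV) {v. v i = 0}" for i :: nat
      using closedin_continuous_map_preimage[OF coord, of "{0}" i] by simp
    then have "closedin (powertop_real UNIV) (\<Inter>i\<in>{n..}. {v. v i = 0})"
      by (intro closedin_Inter) auto
    then have "closedin (powertop_real UNIV) ((\<Inter>i\<in>{n..}. {v. v i = 0}) \<inter> {v. (\<Sum>i<n. (v i)\<^sup>2) \<le> 1})"
      using 1 by (rule closedin_Int)
    moreover have "((\<Inter>i\<in>{n..}. {v. v i = 0}) \<inter> {v. (\<Sum>i<n. (v i)\<^sup>2) \<le> 1}) = disc n"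
      by (auto simp: disc_def)
    ultimately show ?thesis
      by simp
  qed
  moreover have "-1 \<le> v i \<and> v i \<le> 1" if "v \<in> disc n" for v i
    using disc_component_le[OF that, of i] by (simp add: abs_le_iff)
  then have "disc n \<subseteq> ?Q"
    by auto
  ultimately have "compactin (powertop_real UNIV) (disc n)"
    using closed_compactin by blast
  then show ?thesis
    by (simp add: disc_top_def compact_space_subtopology)
qed

definition disc_line :: "real \<Rightarrow> (nat \<Rightarrow> real) \<Rightarrow> (nat \<Rightarrow> real) \<Rightarrow> nat \<Rightarrow> real" where
  "disc_line s u v = (\<lambda>i. (1 - s) * u i + s * v i)"

lemma disc_line_in_disc:
  assumes "u \<in> disc n" "v \<in> disc n" "0 \<le> s" "s \<le> 1"
  shows "disc_line s u v \<in> disc n"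
proof -
  have "disc_norm n (disc_line s u v) \<le> disc_norm n (\<lambda>i. (1 - s) * u i) + disc_norm n (\<lambda>i. s * v i)"
    unfolding disc_line_def by (rule L2_set_triangle_ineq)
  also have "\<dots> = (1 - s) * disc_norm n u + s * disc_norm n v"
    using assms by (simp add: L2_set_right_distrib)
  also have "\<dots> \<le> (1 - s) * 1 + s * 1"
    using assms by (intro add_mono mult_left_mono) (auto simp: disc_iff)
  finally show ?thesis
    using assms by (auto simp: disc_iff disc_line_def)
qed

text \<open>Expansion by the factor \<open>1 + t\<close> followed by radial retraction to the unit
  disc. Boundary points stay fixed, and at time 1 every point of norm at least 1/2 has reached the
  boundary.\<close>

definition disc_push :: "nat \<Rightarrow> real \<Rightarrow> (nat \<Rightarrow> real) \<Rightarrow> nat \<Rightarrow> real" where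
  "disc_push n t v = (\<lambda>i. (1 + t) / max 1 ((1 + t) * disc_norm n v) * v i)"

lemma disc_norm_push:
  assumes "0 \<le> t"
  shows "disc_norm n (disc_push n t v) = (1 + t) * disc_norm n v / max 1 ((1 + t) * disc_norm n v)"
proof -
  have "0 \<le> (1 + t) / max 1 ((1 + t) * disc_norm n v)"
    using assms by simp
  from L2_set_right_distrib[OF this, of v "{..<n}"] show ?thesis
    by (simp add: disc_push_def)
qed

lemma disc_push_in_disc: "0 \<le> t \<Longrightarrow> v \<in> disc n \<Longrightarrow> disc_push n t v \<in> disc n"
  by (auto simp: disc_iff disc_norm_push divide_le_eq) (auto simp: disc_push_def)

lemma disc_push_in_disc_bd:
  "v \<in> disc n \<Longrightarrow> 1/2 \<le> disc_norm n v \<Longrightarrow> disc_push n 1 v \<in> disc_bd n"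
  by (auto simp: disc_iff disc_bd_iff disc_norm_push) (auto simp: disc_push_def)

lemma disc_push_bd: "0 \<le> t \<Longrightarrow> v \<in> disc_bd n \<Longrightarrow> disc_push n t v = v"
  by (auto simp: disc_bd_iff disc_push_def fun_eq_iff)

lemma disc_push_0: "v \<in> disc n \<Longrightarrow> disc_push n 0 v = v"
  by (auto simp: disc_iff disc_push_def)

lemma continuous_map_disc_push:
  "continuous_map (prod_topology (disc_top n) (top_of_set {0..1})) (disc_top n) (\<lambda>(v, t). disc_push n t v)"
proof -
  let ?P = "prod_topology (disc_top n) (top_of_set {0..1::real})"
  have t: "continuous_map ?P euclideanreal snd"
    using continuous_map_snd continuous_map_into_fulltopology by blast
  have v: "continuous_map ?P euclideanreal (\<lambda>p. fst p i)" for i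
    using continuous_map_compose[OF continuous_map_fst continuous_map_disc_coordinate] by (simp add: o_def)
  have n: "continuous_map ?P euclideanreal (\<lambda>p. disc_norm n (fst p))"
    using continuous_map_compose[OF continuous_map_fst continuous_map_disc_norm] by (simp add: o_def)
  have "continuous_map ?P euclideanreal
      (\<lambda>p. (1 + snd p) / max 1 ((1 + snd p) * disc_norm n (fst p)) * fst p i)" for i
    by (intro continuous_map_real_mult continuous_map_real_divide continuous_map_real_max
        continuous_map_add t v n) auto
  then show ?thesis
    using disc_push_in_disc
    by (auto simp: continuous_map_disc_top case_prod_unfold disc_push_def)
qed

section \<open>Weak local equiconnectedness and cell attachment\<close>

text \<open>
  The paths \<open>\<alpha>\<close> and \<open>\<beta>\<close> start at \<open>f\<close> and \<open>g\<close>; they meet at time 1 only near \<open>D\<close>, the set of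
  interest on which \<open>f = g\<close>. On \<open>D\<close> itself they need not be constant, but they coincide: so
  cutting both off at an earlier common time still makes them meet there, which is what allows
  two such families of paths to be glued by a cutoff function.
\<close>

definition tied :: "'z topology \<Rightarrow> 'y topology \<Rightarrow> 'y \<Rightarrow> 'z set \<Rightarrow> ('z \<Rightarrow> 'y) \<Rightarrow> ('z \<Rightarrow> 'y) \<Rightarrow> bool" where
  "tied Z Y y0 D f g \<longleftrightarrow> (\<exists>\<alpha> \<beta> V.
     continuous_map (prod_topology Z euclideanreal) Y (\<lambda>(z, t). \<alpha> z t) \<and>
     continuous_map (prod_topology Z euclideanreal) Y (\<lambda>(z, t). \<beta> z t) \<and>
     (\<forall>z\<in>topspace Z. \<alpha> z 0 = f z \<and> \<beta> z 0 = g z) \<and>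
     (\<forall>z\<in>D. \<forall>t. \<alpha> z t = \<beta> z t \<and> (f z = y0 \<longrightarrow> \<alpha> z t = y0)) \<and>
     openin Z V \<and> D \<subseteq> V \<and> (\<forall>z\<in>V. \<alpha> z 1 = \<beta> z 1))"

lemma homotopy_concat:
  assumes A: "continuous_map (prod_topology Z euclideanreal) Y (\<lambda>(z, t). A z t)"
    and B: "continuous_map (prod_topology Z euclideanreal) Y (\<lambda>(z, t). B z t)"
    and AB: "\<And>z. z \<in> topspace Z \<Longrightarrow> A z 1 = B z 0"
  shows "continuous_map (prod_topology Z euclideanreal) Y
           (\<lambda>(z, t). if t \<le> 1/2 then A z (2 * t) else B z (2 * t - 1))"
proof -
  let ?P = "prod_topology Z euclideanreal"
  have t: "continuous_map ?P euclideanreal snd"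
    by (rule continuous_map_snd)
  have "continuous_map ?P Y (\<lambda>p. if snd p \<le> 1/2 then A (fst p) (2 * snd p) else B (fst p) (2 * snd p - 1))"
  proof (rule continuous_map_cases_le)
    show "continuous_map (subtopology ?P {p \<in> topspace ?P. snd p \<le> 1/2}) Y (\<lambda>p. A (fst p) (2 * snd p))"
      by (intro continuous_map_from_subtopology continuous_map_compose2[OF A] continuous_map_fst
          continuous_map_real_mult t) auto
    show "continuous_map (subtopology ?P {p \<in> topspace ?P. 1/2 \<le> snd p}) Y (\<lambda>p. B (fst p) (2 * snd p - 1))"
      by (intro continuous_map_from_subtopology continuous_map_compose2[OF B] continuous_map_fst
          continuous_map_diff continuous_map_real_mult t) auto
    show "A (fst p) (2 * snd p) = B (fst p) (2 * snd p - 1)" if "p \<in> topspace ?P" "snd p = 1/2" for p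
    proof -
      have "2 * snd p = 1" "2 * snd p - 1 = 0"
        using that by auto
      then show ?thesis
        using AB[of "fst p"] that(1) by (simp only:) auto
    qed
  qed (use t in auto)
  then show ?thesis
    by (simp add: case_prod_unfold)
qed

text \<open>The moves \<open>A\<close> and \<open>B\<close> are put in front of the given tied
  paths, both at double speed. Agreement at time 1 is inherited from the given paths, so the moves
  need to agree only on \<open>D\<close>.\<close>

lemma tied_step:
  assumes A: "continuous_map (prod_topology Z euclideanreal) Y (\<lambda>(z, t). A z t)"
    and B: "continuous_map (prod_topology Z euclideanreal) Y (\<lambda>(z, t). B z t)"
    and A01: "\<And>z. z \<in> topspace Z \<Longrightarrow> A z 0 = f z" "\<And>z. z \<in> topspace Z \<Longrightarrow> A z 1 = f' z"
    and B01: "\<And>z. z \<in> topspace Z \<Longrightarrow> B z 0 = g z" "\<And>z. z \<in> topspace Z \<Longrightarrow> B z 1 = g' z"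
    and AB: "\<And>z t. z \<in> D \<Longrightarrow> A z t = B z t"
    and y0: "\<And>z t. z \<in> D \<Longrightarrow> f z = y0 \<Longrightarrow> A z t = y0"
    and "tied Z Y y0 D f' g'"
  shows "tied Z Y y0 D f g"
proof -
  obtain \<alpha> \<beta> V where
    \<alpha>: "continuous_map (prod_topology Z euclideanreal) Y (\<lambda>(z, t). \<alpha> z t)" and
    \<beta>: "continuous_map (prod_topology Z euclideanreal) Y (\<lambda>(z, t). \<beta> z t)" and
    0: "\<And>z. z \<in> topspace Z \<Longrightarrow> \<alpha> z 0 = f' z" "\<And>z. z \<in> topspace Z \<Longrightarrow> \<beta> z 0 = g' z" and
    D: "\<And>z t. z \<in> D \<Longrightarrow> \<alpha> z t = \<beta> z t" "\<And>z t. z \<in> D \<Longrightarrow> f' z = y0 \<Longrightarrow> \<alpha> z t = y0" and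
    V: "openin Z V" "D \<subseteq> V" "\<And>z. z \<in> V \<Longrightarrow> \<alpha> z 1 = \<beta> z 1"
    using assms(9) unfolding tied_def by blast
  let ?\<alpha> = "\<lambda>z t. if t \<le> 1/2 then A z (2 * t) else \<alpha> z (2 * t - 1)"
  let ?\<beta> = "\<lambda>z t. if t \<le> 1/2 then B z (2 * t) else \<beta> z (2 * t - 1)"
  have "D \<subseteq> topspace Z"
    using V openin_subset by blast
  \<comment> \<open>The basepoint clause of the later paths refers to \<open>f'\<close>, so the
    basepoint has to be carried to the end of the first move.\<close>
  then have y0': "f' z = y0" if "z \<in> D" "f z = y0" for z
    using that y0 A01 by (metis subsetD)
  have "continuous_map (prod_topology Z euclideanreal) Y (\<lambda>(z, t). ?\<alpha> z t)"
    by (rule homotopy_concat[OF A \<alpha>]) (simp add: A01 0)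
  moreover have "continuous_map (prod_topology Z euclideanreal) Y (\<lambda>(z, t). ?\<beta> z t)"
    by (rule homotopy_concat[OF B \<beta>]) (simp add: B01 0)
  moreover have "\<forall>z\<in>topspace Z. ?\<alpha> z 0 = f z \<and> ?\<beta> z 0 = g z"
    by (simp add: A01 B01)
  moreover have "\<forall>z\<in>D. \<forall>t. ?\<alpha> z t = ?\<beta> z t \<and> (f z = y0 \<longrightarrow> ?\<alpha> z t = y0)"
    by (simp add: AB[symmetric] D(1)[symmetric] D(2) y0 y0')
  moreover have "\<forall>z\<in>V. ?\<alpha> z 1 = ?\<beta> z 1"
    by (simp add: V)
  ultimately show ?thesis
    unfolding tied_def using V(1,2) by blast
qed

text \<open>Near the diagonal, running along \<alpha> and then back along \<beta> joins the first
  coordinate to the second. The usual notion of local equiconnectedness would make this path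
  constant on the diagonal; here it only retraces itself, apart from being constant at
  \<open>(y0, y0)\<close>.\<close>

definition lec :: "'y topology \<Rightarrow> 'y \<Rightarrow> bool" where
  "lec Y y0 \<longleftrightarrow> tied (prod_topology Y Y) Y y0 {p \<in> topspace (prod_topology Y Y). fst p = snd p} fst snd"

lemma lecE:
  assumes "lec Y y0"
  obtains \<alpha> \<beta> V where
    "continuous_map (prod_topology (prod_topology Y Y) euclideanreal) Y (\<lambda>(z, t). \<alpha> z t)"
    "continuous_map (prod_topology (prod_topology Y Y) euclideanreal) Y (\<lambda>(z, t). \<beta> z t)"
    "\<And>p q. p \<in> topspace Y \<Longrightarrow> q \<in> topspace Y \<Longrightarrow> \<alpha> (p, q) 0 = p"
    "\<And>p q. p \<in> topspace Y \<Longrightarrow> q \<in> topspace Y \<Longrightarrow> \<beta> (p, q) 0 = q"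
    "\<And>p t. p \<in> topspace Y \<Longrightarrow> \<alpha> (p, p) t = \<beta> (p, p) t"
    "\<And>t. y0 \<in> topspace Y \<Longrightarrow> \<alpha> (y0, y0) t = y0"
    "openin (prod_topology Y Y) V" "\<And>p. p \<in> topspace Y \<Longrightarrow> (p, p) \<in> V"
    "\<And>z. z \<in> V \<Longrightarrow> \<alpha> z 1 = \<beta> z 1"
proof -
  let ?D = "{p \<in> topspace (prod_topology Y Y). fst p = snd p}"
  obtain \<alpha> \<beta> V where *:
    "continuous_map (prod_topology (prod_topology Y Y) euclideanreal) Y (\<lambda>(z, t). \<alpha> z t)"
    "continuous_map (prod_topology (prod_topology Y Y) euclideanreal) Y (\<lambda>(z, t). \<beta> z t)"
    "\<forall>z\<in>topspace (prod_topology Y Y). \<alpha> z 0 = fst z \<and> \<beta> z 0 = snd z"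
    "\<forall>z\<in>?D. \<forall>t. \<alpha> z t = \<beta> z t \<and> (fst z = y0 \<longrightarrow> \<alpha> z t = y0)"
    "openin (prod_topology Y Y) V" "?D \<subseteq> V" "\<forall>z\<in>V. \<alpha> z 1 = \<beta> z 1"
    using assms unfolding lec_def tied_def by blast
  have diag: "(p, p) \<in> ?D" if "p \<in> topspace Y" for p
    using that by simp
  show thesis
  proof (rule that[of \<alpha> \<beta> V])
    show "\<alpha> (p, q) 0 = p" "\<beta> (p, q) 0 = q" if "p \<in> topspace Y" "q \<in> topspace Y" for p q
      using *(3)[rule_format, of "(p, q)"] that by auto
    show "\<alpha> (p, p) t = \<beta> (p, p) t" if "p \<in> topspace Y" for p t
      using *(4)[rule_format, OF diag[OF that]] by simp
    show "\<alpha> (y0, y0) t = y0" if "y0 \<in> topspace Y" for t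
      using *(4)[rule_format, OF diag[OF that]] by (metis fst_conv)
    show "(p, p) \<in> V" if "p \<in> topspace Y" for p
      using *(6) diag[OF that] by blast
  qed (use * in auto)
qed

text \<open>One open cell \<open>c\<close> is attached to a compact \<open>L\<close> by the
  characteristic map \<Phi>; the inverse \<psi> provides coordinates on the open cell.\<close>

locale cell_attachment =
  fixes Y :: "'y topology" and L :: "'y set" and y0 :: 'y and n :: nat
    and \<Phi> :: "(nat \<Rightarrow> real) \<Rightarrow> 'y" and c :: "'y set" and \<psi> :: "'y \<Rightarrow> nat \<Rightarrow> real"
  assumes Hausdorff: "Hausdorff_space Y" and compact_L: "compactin Y L" and y0_L: "y0 \<in> L"
    and cont_\<Phi>: "continuous_map (disc_top n) Y \<Phi>" and \<Phi>_bd: "\<Phi> ` disc_bd n \<subseteq> L"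
    and c_Y: "c \<subseteq> topspace Y" and disjoint: "c \<inter> L = {}"
    and homeo: "homeomorphic_maps (subtopology (disc_top n) (disc n - disc_bd n)) (subtopology Y c) \<Phi> \<psi>"
begin

definition "L' = L \<union> c"
abbreviation "LY \<equiv> subtopology Y L"
abbreviation "LY' \<equiv> subtopology Y L'"

lemma \<psi>_in: "y \<in> c \<Longrightarrow> \<psi> y \<in> disc n - disc_bd n"
  using homeo c_Y by (auto simp: homeomorphic_maps_def continuous_map_def Pi_iff)

lemma \<Phi>_\<psi> [simp]: "y \<in> c \<Longrightarrow> \<Phi> (\<psi> y) = y"
  using homeo c_Y by (auto simp: homeomorphic_maps_def)

lemma \<Phi>_in_c: "v \<in> disc n - disc_bd n \<Longrightarrow> \<Phi> v \<in> c"
  using homeo by (auto simp: homeomorphic_maps_def continuous_map_def Pi_iff)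

lemma \<psi>_\<Phi> [simp]: "v \<in> disc n - disc_bd n \<Longrightarrow> \<psi> (\<Phi> v) = v"
  using homeo by (auto simp: homeomorphic_maps_def)

lemma \<Phi>_bd_not_c: "v \<in> disc_bd n \<Longrightarrow> \<Phi> v \<notin> c"
  using \<Phi>_bd disjoint by blast

lemma \<Phi>_Y: "v \<in> disc n \<Longrightarrow> \<Phi> v \<in> topspace Y"
  using continuous_map_image_subset_topspace[OF cont_\<Phi>] by auto

lemma L_Y: "L \<subseteq> topspace Y"
  using compact_L by (rule compactin_subset_topspace)

lemma \<Phi>_disc: "v \<in> disc n \<Longrightarrow> \<Phi> v \<in> L'"
  using \<Phi>_in_c[of v] \<Phi>_bd by (auto simp: L'_def)

lemma L'_eq: "L' = L \<union> \<Phi> ` disc n"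
proof -
  have "c \<subseteq> \<Phi> ` disc n"
    using \<psi>_in by (metis DiffD1 \<Phi>_\<psi> imageI subsetI)
  then show ?thesis
    using \<Phi>_disc unfolding L'_def by blast
qed

lemma topspace_LY [simp]: "topspace LY = L"
  using compactin_subset_topspace[OF compact_L] by auto

lemma topspace_LY' [simp]: "topspace LY' = L'"
  using compactin_subset_topspace[OF compact_L] c_Y by (auto simp: L'_def)

lemma continuous_map_\<Phi>': "continuous_map (disc_top n) LY' \<Phi>"
  using cont_\<Phi> \<Phi>_disc by (auto simp: continuous_map_in_subtopology)

lemma continuous_map_\<psi>: "continuous_map (subtopology Y c) (disc_top n) \<psi>"
  using homeo unfolding homeomorphic_maps_def by (auto dest: continuous_map_into_fulltopology)

lemma compact_L': "compactin Y L'"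
proof -
  have "compactin (disc_top n) (disc n)"
    using compact_space_disc_top[of n] by (simp add: compact_space_def)
  then have "compactin Y (\<Phi> ` disc n)"
    using cont_\<Phi> by (rule image_compactin)
  then show ?thesis
    unfolding L'_eq using compact_L by (intro compactin_Un)
qed

text \<open>The preimage of a closed set is the union of the images of two compact sets, one from
  \<open>L\<close> and one from the disc, and compact sets are closed in a Hausdorff space. The
  factor \<open>T\<close> admits a time parameter.\<close>

lemma continuous_map_on_attachment:
  assumes T: "compact_space T" "Hausdorff_space T"
    and GL: "continuous_map (prod_topology LY T) M (\<lambda>(y, t). G y t)"
    and GD: "continuous_map (prod_topology (disc_top n) T) M (\<lambda>(v, t). G (\<Phi> v) t)"
  shows "continuous_map (prod_topology LY' T) M (\<lambda>(y, t). G y t)"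
  unfolding continuous_map_closedin
proof (intro conjI allI impI)
  show "(\<lambda>(y, t). G y t) \<in> topspace (prod_topology LY' T) \<rightarrow> topspace M"
    using continuous_map_image_subset_topspace[OF GL] continuous_map_image_subset_topspace[OF GD]
    by (fastforce simp: L'_eq)
next
  fix C assume C: "closedin M C"
  let ?P1 = "{p \<in> topspace (prod_topology LY T). (case p of (y, t) \<Rightarrow> G y t) \<in> C}"
  let ?P2 = "{p \<in> topspace (prod_topology (disc_top n) T). (case p of (v, t) \<Rightarrow> G (\<Phi> v) t) \<in> C}"
  let ?f = "\<lambda>p. (\<Phi> (fst p), snd p)"
  have Haus: "Hausdorff_space (prod_topology LY' T)"
    using Hausdorff T by (simp add: Hausdorff_space_prod_topology Hausdorff_space_subtopology)
  have "compactin (prod_topology LY T) ?P1"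
    using closedin_continuous_map_preimage[OF GL C] compact_L T
    by (intro closedin_compact_space) (auto simp: compact_space_prod_topology compact_space_subtopology)
  moreover have "continuous_map (prod_topology LY T) (prod_topology LY' T) (\<lambda>p. (fst p, snd p))"
    by (intro continuous_map_pairedI continuous_map_snd continuous_map_into_subtopology
        continuous_map_into_fulltopology[OF continuous_map_fst]) (auto simp: L'_def)
  ultimately have "compactin (prod_topology LY' T) ((\<lambda>p. (fst p, snd p)) ` ?P1)"
    by (rule image_compactin)
  then have 1: "closedin (prod_topology LY' T) ?P1"
    using Haus by (simp add: compactin_imp_closedin)
  have "compactin (prod_topology (disc_top n) T) ?P2"
    using closedin_continuous_map_preimage[OF GD C] T compact_space_disc_top[of n]
    by (intro closedin_compact_space) (auto simp: compact_space_prod_topology)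
  moreover have "continuous_map (prod_topology (disc_top n) T) (prod_topology LY' T) ?f"
    using continuous_map_compose[OF continuous_map_fst continuous_map_\<Phi>']
    by (intro continuous_map_pairedI continuous_map_snd) (simp add: o_def)
  ultimately have "compactin (prod_topology LY' T) (?f ` ?P2)"
    by (rule image_compactin)
  then have 2: "closedin (prod_topology LY' T) (?f ` ?P2)"
    using Haus by (simp add: compactin_imp_closedin)
  have "{p \<in> topspace (prod_topology LY' T). (case p of (y, t) \<Rightarrow> G y t) \<in> C} = ?P1 \<union> ?f ` ?P2"
    using L_Y \<Phi>_Y by (auto simp: L'_eq image_iff)
  then show "closedin (prod_topology LY' T) {p \<in> topspace (prod_topology LY' T). (case p of (y, t) \<Rightarrow> G y t) \<in> C}"
    using closedin_Un[OF 1 2] by simp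
qed

text \<open>The value 1 off the cell matches the norm on the boundary of the disc; this makes the
  function continuous on all of \<open>L'\<close>.\<close>

definition radius :: "'y \<Rightarrow> real" where
  "radius y = (if y \<in> c then disc_norm n (\<psi> y) else 1)"

definition push :: "'y \<Rightarrow> real \<Rightarrow> 'y" where
  "push y t = (if y \<in> c then \<Phi> (disc_push n t (\<psi> y)) else y)"

lemma radius_\<Phi>: "v \<in> disc n \<Longrightarrow> radius (\<Phi> v) = disc_norm n v"
  using \<Phi>_in_c[of v] \<Phi>_bd_not_c[of v] by (cases "v \<in> disc_bd n") (simp_all add: radius_def disc_bd_iff)

lemma radius_L: "y \<in> L \<Longrightarrow> radius y = 1"
  using disjoint by (auto simp: radius_def)

lemma radius_less_1: "y \<in> L' \<Longrightarrow> radius y < 1 \<Longrightarrow> y \<in> c"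
  using radius_L[of y] by (auto simp: L'_def)

lemma push_\<Phi>: "0 \<le> t \<Longrightarrow> v \<in> disc n \<Longrightarrow> push (\<Phi> v) t = \<Phi> (disc_push n t v)"
  using \<Phi>_in_c[of v] \<Phi>_bd_not_c[of v] by (cases "v \<in> disc_bd n") (simp_all add: push_def disc_push_bd)

lemma push_L: "y \<in> L \<Longrightarrow> push y t = y"
  using disjoint by (auto simp: push_def)

lemma push_0: "y \<in> L' \<Longrightarrow> push y 0 = y"
  using \<psi>_in[of y] by (auto simp: push_def disc_push_0)

lemma push_1:
  assumes "y \<in> L'" "1/2 \<le> radius y"
  shows "push y 1 \<in> L"
proof (cases "y \<in> c")
  case True
  then show ?thesis
    using assms \<psi>_in[OF True] disc_push_in_disc_bd[of "\<psi> y" n] \<Phi>_bd by (auto simp: push_def radius_def)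
qed (use assms in \<open>auto simp: push_def L'_def\<close>)

lemma continuous_map_radius: "continuous_map LY' euclideanreal radius"
proof -
  let ?I = "top_of_set {0..1::real}"
  \<comment> \<open>The interval is a dummy parameter, introduced to fit the attachment lemma and
    removed by evaluating at 0.\<close>
  have "continuous_map (prod_topology LY' ?I) euclideanreal (\<lambda>(y, t). radius y)"
  proof (rule continuous_map_on_attachment)
    have "continuous_map (prod_topology LY ?I) euclideanreal (\<lambda>p. 1)"
      by simp
    then show "continuous_map (prod_topology LY ?I) euclideanreal (\<lambda>(y, t). radius y)"
      by (rule continuous_map_eq) (auto simp: radius_L)
    have "continuous_map (prod_topology (disc_top n) ?I) euclideanreal (disc_norm n \<circ> fst)"
      by (rule continuous_map_compose[OF continuous_map_fst continuous_map_disc_norm])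
    then show "continuous_map (prod_topology (disc_top n) ?I) euclideanreal (\<lambda>(v, t). radius (\<Phi> v))"
      by (rule continuous_map_eq) (auto simp: radius_\<Phi>)
  qed (auto simp: compact_space_subtopology Hausdorff_space_subtopology)
  from continuous_map_compose2[OF this continuous_map_id, of "\<lambda>_. 0"] show ?thesis
    by (simp add: id_def)
qed

lemma continuous_map_push:
  "continuous_map (prod_topology LY' (top_of_set {0..1::real})) LY' (\<lambda>(y, t). push y t)"
proof (rule continuous_map_on_attachment)
  let ?I = "top_of_set {0..1::real}"
  have "continuous_map (prod_topology LY ?I) LY' fst"
    by (intro continuous_map_into_subtopology
        continuous_map_into_fulltopology[OF continuous_map_fst]) (auto simp: L'_def)
  then show "continuous_map (prod_topology LY ?I) LY' (\<lambda>(y, t). push y t)"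
    by (rule continuous_map_eq) (auto simp: push_L)
  have "continuous_map (prod_topology (disc_top n) ?I) LY' (\<Phi> \<circ> (\<lambda>(v, t). disc_push n t v))"
    by (rule continuous_map_compose[OF continuous_map_disc_push continuous_map_\<Phi>'])
  then show "continuous_map (prod_topology (disc_top n) ?I) LY' (\<lambda>(v, t). push (\<Phi> v) t)"
    by (rule continuous_map_eq) (auto simp: push_\<Phi>)
qed (auto simp: compact_space_subtopology Hausdorff_space_subtopology)

lemma continuous_map_LY_LY': "continuous_map W LY h \<Longrightarrow> continuous_map W LY' h"
  by (auto simp: continuous_map_in_subtopology L'_def)

text \<open>Both endpoints must lie in the open cell because \<psi> is continuous only there;
  convexity of the disc keeps the segment inside the domain of \<Phi>.\<close>

lemma continuous_map_cell_line:
  assumes f: "continuous_map W LY' f" "f \<in> topspace W \<rightarrow> c"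
    and g: "continuous_map W LY' g" "g \<in> topspace W \<rightarrow> c"
    and s: "continuous_map W euclideanreal s" "\<And>w. w \<in> topspace W \<Longrightarrow> 0 \<le> s w \<and> s w \<le> 1"
  shows "continuous_map W LY' (\<lambda>w. \<Phi> (disc_line (s w) (\<psi> (f w)) (\<psi> (g w))))"
proof -
  have \<psi>: "continuous_map W (disc_top n) (\<lambda>w. \<psi> (h w))"
    if "continuous_map W LY' h" "h \<in> topspace W \<rightarrow> c" for h
  proof -
    have "continuous_map W (subtopology Y c) h"
      using continuous_map_into_fulltopology[OF that(1)] that(2) by (rule continuous_map_into_subtopology)
    from continuous_map_compose[OF this continuous_map_\<psi>] show ?thesis
      by (simp add: o_def)
  qed
  have coord: "continuous_map W euclideanreal (\<lambda>w. \<psi> (h w) i)"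
    if "continuous_map W LY' h" "h \<in> topspace W \<rightarrow> c" for h i
    using \<psi>[OF that] by (simp add: continuous_map_disc_top)
  have "continuous_map W euclideanreal (\<lambda>w. (1 - s w) * \<psi> (f w) i + s w * \<psi> (g w) i)" for i
    by (intro continuous_map_add continuous_map_real_mult continuous_map_diff s coord f g) auto
  moreover have "disc_line (s w) (\<psi> (f w)) (\<psi> (g w)) \<in> disc n" if "w \<in> topspace W" for w
    using that f(2) g(2) s(2)[OF that] \<psi>_in by (intro disc_line_in_disc) blast+
  ultimately have "continuous_map W (disc_top n) (\<lambda>w. disc_line (s w) (\<psi> (f w)) (\<psi> (g w)))"
    by (auto simp: continuous_map_disc_top disc_line_def)
  from continuous_map_compose[OF this continuous_map_\<Phi>'] show ?thesis
    by (simp add: o_def)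
qed

lemma continuous_map_push_compose:
  assumes "continuous_map W LY' f" "continuous_map W euclideanreal s"
    and "\<And>w. w \<in> topspace W \<Longrightarrow> 0 \<le> s w \<and> s w \<le> 1"
  shows "continuous_map W LY' (\<lambda>w. push (f w) (s w))"
  using assms by (intro continuous_map_compose2[OF continuous_map_push])
    (auto simp: continuous_map_in_subtopology)

text \<open>The induction step over cells. The cutoffs overlap so that a neighbourhood of the
  diagonal is covered: there both radii coincide, and their common value is either below 3/4, where
  the segment is complete, or above 5/8, where the push and the motion inside \<open>L\<close> are
  complete.\<close>

lemma lec_attach:
  assumes "lec LY y0"
  shows "lec LY' y0"
proof -
  define Z where "Z = prod_topology LY' LY'"
  define D where "D = {p \<in> topspace Z. fst p = snd p}"
  define P where "P = prod_topology Z euclideanreal"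
  define f g :: "'y \<times> 'y \<Rightarrow> 'y" where "f = fst" and "g = snd"
  have f: "continuous_map Z LY' f" and g: "continuous_map Z LY' g"
    by (auto simp: Z_def f_def g_def continuous_map_fst continuous_map_snd)
  have D: "z \<in> topspace Z" "f z = g z" if "z \<in> D" for z
    using that by (auto simp: D_def f_def g_def)
  have on_L': "h z \<in> L'" if "continuous_map Z LY' h" "z \<in> topspace Z" for h z
    using continuous_map_image_subset_topspace[OF that(1)] that(2) by auto
  have fstP: "continuous_map P Z fst" and sndP: "continuous_map P euclideanreal snd"
    by (auto simp: P_def continuous_map_fst continuous_map_snd)
  have onP: "continuous_map P M (\<lambda>p. h (fst p))" if "continuous_map Z M h" for M :: "'m topology" and h
    using continuous_map_compose[OF fstP that] by (simp add: o_def)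
  have at_1: "continuous_map Z M (\<lambda>z. h z 1)" if "continuous_map P M (\<lambda>(z, t). h z t)" for M :: "'m topology" and h
    using continuous_map_compose2[OF that[unfolded P_def] continuous_map_id, of "\<lambda>_. 1"] by simp
  have radius: "continuous_map Z euclideanreal (\<lambda>z. radius (h z))" if "continuous_map Z LY' h" for h
    using continuous_map_compose[OF that continuous_map_radius] by (simp add: o_def)

  \<comment> \<open>First \<open>f\<close> moves along a segment of the cell to \<open>g\<close> where both are well inside the cell.\<close>
  define mx where "mx = (\<lambda>z. max (radius (f z)) (radius (g z)))"
  \<comment> \<open>\<eta> is 1 for \<open>mx z \<le> 3/4\<close>, so \<open>f\<close> arrives at
    \<open>g\<close>, and 0 at 7/8, so the two branches of \<open>A\<close> agree there. Up to 7/8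
    both radii are below 1, which puts both points in \<open>c\<close>.\<close>
  define \<eta> where "\<eta> = (\<lambda>z. clamp01 (7 - 8 * mx z))"
  define A where "A = (\<lambda>z t. if mx z \<le> 7/8
      then \<Phi> (disc_line (\<eta> z * clamp01 t) (\<psi> (f z)) (\<psi> (g z))) else f z)"
  have mx: "continuous_map Z euclideanreal mx"
    unfolding mx_def by (intro continuous_map_real_max radius f g)
  have \<eta>: "continuous_map Z euclideanreal \<eta>"
    unfolding \<eta>_def by (intro continuous_map_clamp01 continuous_map_diff continuous_map_real_mult mx) auto
  have in_c: "f z \<in> c" "g z \<in> c" if "z \<in> topspace Z" "mx z \<le> 7/8" for z
    using that radius_less_1[OF on_L'[OF f]] radius_less_1[OF on_L'[OF g]] by (auto simp: mx_def)
  have line_0: "\<Phi> (disc_line 0 (\<psi> y) v) = y" if "y \<in> c" for y v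
    using that by (simp add: disc_line_def)
  have line_1: "\<Phi> (disc_line 1 v (\<psi> y)) = y" if "y \<in> c" for y v
    using that by (simp add: disc_line_def)
  have line_eq: "\<Phi> (disc_line s (\<psi> y) (\<psi> y)) = y" if "y \<in> c" for y s
    using that by (simp add: disc_line_def algebra_simps)
  have A: "continuous_map P LY' (\<lambda>(z, t). A z t)"
  proof -
    have "continuous_map P LY' (\<lambda>p. if mx (fst p) \<le> 7/8
       then \<Phi> (disc_line (\<eta> (fst p) * clamp01 (snd p)) (\<psi> (f (fst p))) (\<psi> (g (fst p)))) else f (fst p))"
    proof (rule continuous_map_cases_le)
      let ?W = "subtopology P {p \<in> topspace P. mx (fst p) \<le> 7/8}"
      have W: "fst p \<in> topspace Z \<and> mx (fst p) \<le> 7/8" if "p \<in> topspace ?W" for p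
        using that by (auto simp: P_def)
      show "continuous_map ?W LY' (\<lambda>p. \<Phi> (disc_line (\<eta> (fst p) * clamp01 (snd p)) (\<psi> (f (fst p))) (\<psi> (g (fst p)))))"
        using W in_c
        by (intro continuous_map_cell_line continuous_map_from_subtopology onP[OF f] onP[OF g]
            continuous_map_real_mult onP[OF \<eta>] continuous_map_clamp01 sndP)
          (auto simp: \<eta>_def mult_le_one)
      show "\<Phi> (disc_line (\<eta> (fst p) * clamp01 (snd p)) (\<psi> (f (fst p))) (\<psi> (g (fst p)))) = f (fst p)"
        if "p \<in> topspace P" "mx (fst p) = 7/8" for p
        using that in_c(1)[of "fst p"] by (auto simp: \<eta>_def line_0 P_def)
    qed (auto intro: onP mx continuous_map_from_subtopology f)
    then show ?thesis
      by (simp add: A_def case_prod_unfold)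
  qed
  define f1 where "f1 = (\<lambda>z. A z 1)"
  have f1: "continuous_map Z LY' f1"
    unfolding f1_def by (rule at_1[OF A])
  have f1_eq: "f1 z = g z" if "z \<in> topspace Z" "mx z \<le> 3/4" for z
    using that in_c[of z] by (auto simp: f1_def A_def \<eta>_def line_1)
  \<comment> \<open>On the diagonal the segment degenerates to a point, so both branches of
    \<open>A\<close> are stationary.\<close>
  have A_D: "A z t = g z" if "z \<in> D" for z t
    using that D[OF that] in_c[of z] by (auto simp: A_def line_eq)

  \<comment> \<open>Then both points are pushed out of the cell where they are close to its boundary.\<close>
  define m where "m = (\<lambda>z. min (radius (f1 z)) (radius (g z)))"
  \<comment> \<open>\<open>\<kappa>1\<close> reaches 1 at \<open>m z = 9/16\<close>, where both
    radii exceed 1/2 and the full push ends in \<open>L\<close>. \<open>\<kappa>2\<close> is still 0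
    there and reaches 1 at 5/8.\<close>
  define \<kappa>1 where "\<kappa>1 = (\<lambda>z. clamp01 (16 * m z - 8))"
  define \<kappa>2 where "\<kappa>2 = (\<lambda>z. clamp01 (16 * m z - 9))"
  \<comment> \<open>Both points are pushed for the same time, so equal points stay equal.\<close>
  define f2 where "f2 = (\<lambda>z. push (f1 z) (\<kappa>1 z))"
  define g2 where "g2 = (\<lambda>z. push (g z) (\<kappa>1 z))"
  have m: "continuous_map Z euclideanreal m"
    unfolding m_def by (intro continuous_map_real_min radius f1 g)
  have \<kappa>1: "continuous_map Z euclideanreal \<kappa>1" and \<kappa>2: "continuous_map Z euclideanreal \<kappa>2"
    unfolding \<kappa>1_def \<kappa>2_def
    by (intro continuous_map_clamp01 continuous_map_diff continuous_map_real_mult m; simp)+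
  have B: "continuous_map P LY' (\<lambda>(z, t). push (h z) (\<kappa>1 z * clamp01 t))" if "continuous_map Z LY' h" for h
    unfolding case_prod_unfold
    by (intro continuous_map_push_compose onP that continuous_map_real_mult continuous_map_clamp01 \<kappa>1 sndP)
      (auto simp: \<kappa>1_def mult_le_one)
  have f2: "continuous_map Z LY' f2" and g2: "continuous_map Z LY' g2"
    using at_1[OF B[OF f1]] at_1[OF B[OF g]] by (simp_all add: f2_def g2_def)
  have in_L: "f2 z \<in> L" "g2 z \<in> L" if "z \<in> topspace Z" "9/16 \<le> m z" for z
    using that on_L'[OF f1 that(1)] on_L'[OF g that(1)] by (auto simp: f2_def g2_def \<kappa>1_def m_def push_1)

  \<comment> \<open>Finally they are joined inside \<open>L\<close>, for as long as \<open>\<kappa>2\<close> permits. Where the last two moves are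
    cut off before their end, the first one has already made the points equal.\<close>
  obtain \<alpha> \<beta> V where
    \<alpha>: "continuous_map (prod_topology (prod_topology LY LY) euclideanreal) LY (\<lambda>(z, t). \<alpha> z t)" and
    \<beta>: "continuous_map (prod_topology (prod_topology LY LY) euclideanreal) LY (\<lambda>(z, t). \<beta> z t)" and
    0: "\<And>p q. p \<in> L \<Longrightarrow> q \<in> L \<Longrightarrow> \<alpha> (p, q) 0 = p" "\<And>p q. p \<in> L \<Longrightarrow> q \<in> L \<Longrightarrow> \<beta> (p, q) 0 = q" and
    diag: "\<And>p t. p \<in> L \<Longrightarrow> \<alpha> (p, p) t = \<beta> (p, p) t" "\<And>t. \<alpha> (y0, y0) t = y0" and
    V: "openin (prod_topology LY LY) V" "\<And>p. p \<in> L \<Longrightarrow> (p, p) \<in> V" "\<And>z. z \<in> V \<Longrightarrow> \<alpha> z 1 = \<beta> z 1"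
    using assms by (rule lecE) (auto simp: y0_L simp del: topspace_subtopology)
  \<comment> \<open>One construction serves \<alpha> with \<open>f2\<close> and \<beta> with
    \<open>g2\<close>. At \<open>m z = 9/16\<close> the time factor \<open>\<kappa>2 z\<close>
    vanishes, so the branches match.\<close>
  define C :: "('y \<times> 'y \<Rightarrow> real \<Rightarrow> 'y) \<Rightarrow> ('y \<times> 'y \<Rightarrow> 'y) \<Rightarrow> 'y \<times> 'y \<Rightarrow> real \<Rightarrow> 'y"
    where "C = (\<lambda>\<gamma> h z t. if 9/16 \<le> m z then \<gamma> (f2 z, g2 z) (\<kappa>2 z * t) else h z)"
  have C: "continuous_map P LY' (\<lambda>(z, t). C \<gamma> h z t)"
    if \<gamma>: "continuous_map (prod_topology (prod_topology LY LY) euclideanreal) LY (\<lambda>(z, t). \<gamma> z t)"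
      and h: "continuous_map Z LY' h"
      and \<gamma>h: "\<And>z. z \<in> topspace Z \<Longrightarrow> m z = 9/16 \<Longrightarrow> \<gamma> (f2 z, g2 z) 0 = h z" for \<gamma> h
  proof -
    have "continuous_map P LY' (\<lambda>p. if 9/16 \<le> m (fst p)
        then \<gamma> (f2 (fst p), g2 (fst p)) (\<kappa>2 (fst p) * snd p) else h (fst p))"
    proof (rule continuous_map_cases_le)
      let ?W = "subtopology P {p \<in> topspace P. 9/16 \<le> m (fst p)}"
      have onW: "continuous_map ?W LY (\<lambda>p. k (fst p))"
        if "continuous_map Z LY' k" "\<And>z. z \<in> topspace Z \<Longrightarrow> 9/16 \<le> m z \<Longrightarrow> k z \<in> L" for k
        using that continuous_map_into_fulltopology[OF onP[OF that(1)]]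
        by (intro continuous_map_into_subtopology continuous_map_from_subtopology) (auto simp: P_def)
      have "continuous_map ?W LY (\<lambda>p. \<gamma> (f2 (fst p), g2 (fst p)) (\<kappa>2 (fst p) * snd p))"
        by (intro continuous_map_compose2[OF \<gamma>] continuous_map_pairedI continuous_map_real_mult
            onW[OF f2 in_L(1)] onW[OF g2 in_L(2)] continuous_map_from_subtopology[OF onP[OF \<kappa>2]]
            continuous_map_from_subtopology[OF sndP])
      then show "continuous_map ?W LY' (\<lambda>p. \<gamma> (f2 (fst p), g2 (fst p)) (\<kappa>2 (fst p) * snd p))"
        by (rule continuous_map_LY_LY')
      show "\<gamma> (f2 (fst p), g2 (fst p)) (\<kappa>2 (fst p) * snd p) = h (fst p)"
        if "p \<in> topspace P" "9/16 = m (fst p)" for p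
        using that \<gamma>h[of "fst p"] by (auto simp: \<kappa>2_def P_def)
    qed (auto intro: onP m continuous_map_from_subtopology h)
    then show ?thesis
      by (simp add: C_def case_prod_unfold)
  qed

  \<comment> \<open>On \<open>V1\<close> the segment has already made the points equal; on
    \<open>V2 \<inter> V3\<close> the motion in \<open>L\<close> runs to its end and the points meet
    there. \<open>V0\<close> is an open region on which both pushed points lie in
    \<open>L\<close>.\<close>
  define V0 where "V0 = {z \<in> topspace Z. m z > 9/16}"
  define V1 where "V1 = {z \<in> topspace Z. mx z < 3/4}"
  define V2 where "V2 = {z \<in> topspace Z. m z > 5/8}"
  define V3 where "V3 = {z \<in> V0. (f2 z, g2 z) \<in> V}"
  have half: "openin Z {z \<in> topspace Z. k z > a}" if "continuous_map Z euclideanreal k" for k a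
    using openin_continuous_map_preimage[OF that, of "{a<..}"] by simp
  have "openin Z {z \<in> topspace Z. - mx z > - (3/4)}"
    by (rule half) (intro continuous_map_minus mx)
  then have "openin Z V1" "openin Z V2" "openin Z V0"
    using half[OF m, of "5/8"] half[OF m, of "9/16"] by (simp_all add: V1_def V2_def V0_def)
  \<comment> \<open>\<open>V\<close> is open only relative to the square of \<open>L\<close>, so its
    preimage is first seen to be open in \<open>V0\<close> and then in \<open>Z\<close>.\<close>
  have "continuous_map (subtopology Z V0) (prod_topology LY LY) (\<lambda>z. (f2 z, g2 z))"
    using continuous_map_into_fulltopology[OF f2] continuous_map_into_fulltopology[OF g2] in_L
    by (intro continuous_map_pairedI continuous_map_into_subtopology continuous_map_from_subtopology)
      (auto simp: V0_def)
  from openin_continuous_map_preimage[OF this V(1)]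
  have "openin (subtopology Z V0) V3"
    by (simp add: V3_def V0_def conj_ac)
  then have "openin Z V3"
    using \<open>openin Z V0\<close> openin_trans_full by blast
  have open_V: "openin Z (V1 \<union> (V2 \<inter> V3))"
    using \<open>openin Z V1\<close> \<open>openin Z V2\<close> \<open>openin Z V3\<close> by blast
  have D_sub: "D \<subseteq> V1 \<union> (V2 \<inter> V3)"
  proof
    fix z assume z: "z \<in> D"
    then have "f1 z = g z" "f z = g z" "z \<in> topspace Z"
      using A_D D by (auto simp: f1_def)
    moreover have "mx z = radius (g z)" "m z = radius (g z)" "f2 z = g2 z"
      using \<open>f1 z = g z\<close> \<open>f z = g z\<close> by (auto simp: mx_def m_def f2_def g2_def)
    ultimately show "z \<in> V1 \<union> (V2 \<inter> V3)"
      using V(2) in_L(2)[of z] by (cases "radius (g z) < 3/4") (auto simp: V1_def V2_def V3_def V0_def)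
  qed
  \<comment> \<open>On \<open>V1\<close> the pair \<open>(f2 z, g2 z)\<close> is diagonal, where
    \<alpha> and \<beta> agree at every cutoff time; otherwise \<open>\<kappa>2 z = 1\<close> and
    they agree at time 1 by the choice of \<open>V\<close>.\<close>
  have end_eq: "C \<alpha> f2 z 1 = C \<beta> g2 z 1" if z: "z \<in> V1 \<union> (V2 \<inter> V3)" for z
  proof (cases "z \<in> V1")
    case True
    then have "f1 z = g z" "z \<in> topspace Z"
      using f1_eq by (auto simp: V1_def)
    then show ?thesis
      using diag(1) in_L(2)[of z] by (auto simp: C_def f2_def g2_def)
  next
    case False
    then show ?thesis
      using z V(3) by (auto simp: C_def V2_def V3_def \<kappa>2_def)
  qed
  have C_D: "C \<alpha> f2 z t = C \<beta> g2 z t" if "z \<in> D" for z t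
    using D(1)[OF that] A_D[OF that] diag(1) in_L(2)[of z] by (auto simp: C_def f2_def g2_def f1_def)
  have C_y0: "C \<alpha> f2 z t = y0" if "z \<in> D" "f2 z = y0" for z t
    using that D(1)[OF that(1)] A_D[OF that(1)] diag(2) by (auto simp: C_def f2_def g2_def f1_def)
  have C0: "C \<alpha> f2 z 0 = f2 z" "C \<beta> g2 z 0 = g2 z" if "z \<in> topspace Z" for z
    using that in_L[OF that] 0 by (auto simp: C_def)
  have "tied Z LY' y0 D f2 g2"
    unfolding tied_def
    using C[OF \<alpha> f2] C[OF \<beta> g2] in_L 0 open_V D_sub end_eq C_D C_y0 C0
    by (intro exI[of _ "C \<alpha> f2"] exI[of _ "C \<beta> g2"] exI[of _ "V1 \<union> (V2 \<inter> V3)"])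
      (auto simp: P_def)
  \<comment> \<open>The moves are prepended in reverse order: first the push, then the segment,
    during which \<open>g\<close> rests.\<close>
  then have "tied Z LY' y0 D f1 g"
  proof (rule tied_step[OF B[OF f1, unfolded P_def] B[OF g, unfolded P_def], rotated -1])
    fix z t assume z: "z \<in> D"
    then show "push (f1 z) (\<kappa>1 z * clamp01 t) = push (g z) (\<kappa>1 z * clamp01 t)"
      using A_D[OF z] by (simp add: f1_def)
    show "push (f1 z) (\<kappa>1 z * clamp01 t) = y0" if "f1 z = y0"
      using that push_L[OF y0_L] by simp
  qed (auto simp: f2_def g2_def push_0 on_L'[OF f1] on_L'[OF g])
  moreover have "continuous_map P LY' (\<lambda>(z, t). g z)"
    using onP[OF g] by (simp add: case_prod_unfold)
  ultimately have "tied Z LY' y0 D f g"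
  proof (intro tied_step[where f = f and f' = f1 and g = g and g' = g and A = A and B = "\<lambda>z t. g z"])
    show "A z 0 = f z" if "z \<in> topspace Z" for z
      using that in_c[of z] by (auto simp: A_def line_0)
    show "A z t = y0" if "z \<in> D" "f z = y0" for z t
      using that A_D[of z t] D[of z] by simp
  qed (use A A_D in \<open>auto simp: P_def f1_def\<close>)
  then show ?thesis
    by (simp add: lec_def Z_def D_def f_def g_def)
qed

end

section \<open>Finite subcomplexes\<close>

text \<open>Such a set is compact and discrete, hence finite.\<close>

lemma finite_if_all_subsets_closed:
  assumes "compactin Y K" "T \<subseteq> K" and closed: "\<And>S. S \<subseteq> T \<Longrightarrow> closedin Y S"
  shows "finite T"
proof -
  have "compactin Y T"
    using closed_compactin[OF assms(1,2) closed] by simp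
  then have T: "compact_space (subtopology Y T)" "T \<subseteq> topspace Y"
    by (auto simp: compact_space_subtopology dest: compactin_subset_topspace)
  have "openin (subtopology Y T) {x}" if "x \<in> T" for x
  proof -
    have "openin Y (topspace Y - (T - {x}))"
      using closed[of "T - {x}"] by blast
    moreover have "{x} = T \<inter> (topspace Y - (T - {x}))"
      using that T(2) by auto
    ultimately show ?thesis
      by (metis openin_subtopology_Int2)
  qed
  then have "discrete_topology T = subtopology Y T"
    using T(2) by (auto simp: discrete_topology_unique)
  then show ?thesis
    using T(1) compact_space_discrete_topology by metis
qed

lemma lec_singleton:
  assumes "y0 \<in> topspace Y"
  shows "lec (subtopology Y {y0}) y0"
proof -
  define Z where "Z = prod_topology (subtopology Y {y0}) (subtopology Y {y0})"
  have "continuous_map (prod_topology Z euclideanreal) (subtopology Y {y0}) (\<lambda>(z, t). y0)"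
    using assms by (simp add: case_prod_unfold)
  moreover have "fst z = y0" "snd z = y0" if "z \<in> topspace Z" for z
    using that by (auto simp: Z_def)
  ultimately show ?thesis
    unfolding lec_def tied_def Z_def[symmetric]
    by (intro exI[of _ "\<lambda>z t. y0"] exI[of _ "topspace Z"]) auto
qed

text \<open>Characteristic maps \<Phi> and finite families \<open>bnd c\<close> of lower cells
  covering the image of the boundary sphere are fixed once, so that a subcomplex is a family of
  cells closed under \<open>bnd\<close>.\<close>

locale cw_chart =
  fixes Y :: "'y topology" and C :: "'y set set" and cdim :: "'y set \<Rightarrow> nat"
    and \<Phi> :: "'y set \<Rightarrow> (nat \<Rightarrow> real) \<Rightarrow> 'y" and bnd :: "'y set \<Rightarrow> 'y set set"
  assumes Hausdorff: "Hausdorff_space Y" and disjoint: "pairwise disjnt C" and cover: "\<Union>C = topspace Y"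
    and cont: "\<And>c. c \<in> C \<Longrightarrow> continuous_map (disc_top (cdim c)) Y (\<Phi> c)"
    and homeo: "\<And>c. c \<in> C \<Longrightarrow> homeomorphic_map
        (subtopology (disc_top (cdim c)) (disc (cdim c) - disc_bd (cdim c))) (subtopology Y c) (\<Phi> c)"
    and bnd: "\<And>c. c \<in> C \<Longrightarrow> finite (bnd c)" "\<And>c. c \<in> C \<Longrightarrow> bnd c \<subseteq> C"
        "\<And>c d. c \<in> C \<Longrightarrow> d \<in> bnd c \<Longrightarrow> cdim d < cdim c"
        "\<And>c. c \<in> C \<Longrightarrow> \<Phi> c ` disc_bd (cdim c) \<subseteq> \<Union>(bnd c)"
    and weak: "\<And>A. A \<subseteq> topspace Y \<Longrightarrow> (\<And>c. c \<in> C \<Longrightarrow> closedin Y (A \<inter> Y closure_of c)) \<Longrightarrow> closedin Y A"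
begin

lemma same_cell: "c \<in> C \<Longrightarrow> d \<in> C \<Longrightarrow> y \<in> c \<Longrightarrow> y \<in> d \<Longrightarrow> c = d"
  using disjoint unfolding pairwise_def disjnt_iff by blast

lemma cell_Y: "c \<in> C \<Longrightarrow> c \<subseteq> topspace Y"
  using cover by blast

text \<open>The image of the closed disc is compact, hence closed, and contains the cell; its
  boundary part lies in the cells of \<open>bnd c\<close>.\<close>

lemma closure_cell:
  assumes "c \<in> C"
  shows "Y closure_of c \<subseteq> c \<union> \<Union>(bnd c)"
proof -
  let ?n = "cdim c"
  have c: "\<Phi> c ` (disc ?n - disc_bd ?n) = c"
    using homeomorphic_imp_surjective_map[OF homeo[OF assms]] cell_Y[OF assms]
    by (simp add: Int_absorb1)
  have "compactin (disc_top ?n) (disc ?n)"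
    using compact_space_disc_top[of ?n] by (simp add: compact_space_def)
  then have "compactin Y (\<Phi> c ` disc ?n)"
    using cont[OF assms] by (rule image_compactin)
  then have "closedin Y (\<Phi> c ` disc ?n)"
    using Hausdorff compactin_imp_closedin by blast
  moreover have "c \<subseteq> \<Phi> c ` disc ?n"
    by (subst c[symmetric]) (rule image_mono, blast)
  ultimately have "Y closure_of c \<subseteq> \<Phi> c ` disc ?n"
    by (simp add: closure_of_minimal)
  also have "\<dots> \<subseteq> \<Phi> c ` (disc ?n - disc_bd ?n) \<union> \<Phi> c ` disc_bd ?n"
    by blast
  also have "\<dots> \<subseteq> c \<union> \<Union>(bnd c)"
    unfolding c using bnd(4)[OF assms] by (rule Un_mono[OF order_refl])
  finally show ?thesis .
qed

text \<open>Choose one point of \<open>K\<close> in each cell that \<open>K\<close> meets. Any set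
  of chosen points meets the closure of each cell in a finite set and so is closed by the weak
  topology; \<open>finite_if_all_subsets_closed\<close> applies.\<close>

lemma finite_cells_meeting_compact:
  assumes K: "compactin Y K"
  shows "finite {c \<in> C. c \<inter> K \<noteq> {}}"
proof -
  let ?M = "{c \<in> C. c \<inter> K \<noteq> {}}"
  have "\<forall>c\<in>?M. \<exists>y. y \<in> c \<inter> K"
    by blast
  then obtain x where "\<forall>c\<in>?M. x c \<in> c \<inter> K"
    by (rule bchoice[THEN exE])
  then have x: "\<And>c. c \<in> ?M \<Longrightarrow> x c \<in> c \<inter> K"
    by blast
  have inj: "inj_on x ?M"
  proof (rule inj_onI)
    fix c d assume "c \<in> ?M" "d \<in> ?M" "x c = x d"
    then show "c = d"
      using same_cell[of c d "x c"] x[of c] x[of d] by auto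
  qed
  have "closedin Y S" if S: "S \<subseteq> x ` ?M" for S
  proof (rule weak)
    show SY: "S \<subseteq> topspace Y"
      using S x compactin_subset_topspace[OF K] by blast
    fix c assume c: "c \<in> C"
    have "S \<inter> Y closure_of c \<subseteq> x ` insert c (bnd c)"
    proof
      fix y assume y: "y \<in> S \<inter> Y closure_of c"
      then obtain d where d: "d \<in> ?M" "y = x d"
        using y S by blast
      obtain e where e: "e \<in> insert c (bnd c)" "y \<in> e"
        using y closure_cell[OF c] by blast
      moreover have "d = e"
        using same_cell[of d e y] d x[OF d(1)] e bnd(2)[OF c] c by auto
      ultimately show "y \<in> x ` insert c (bnd c)"
        using d by blast
    qed
    then have "finite (S \<inter> Y closure_of c)"
      using bnd(1)[OF c] by (meson finite_imageI finite_insert finite_subset)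
    then show "closedin Y (S \<inter> Y closure_of c)"
      using SY Hausdorff by (intro closedin_Hausdorff_finite) auto
  qed
  then have "finite (x ` ?M)"
    using x by (intro finite_if_all_subsets_closed[OF K]) auto
  then show ?thesis
    using inj finite_imageD by blast
qed

text \<open>By induction on dimension, the cell is added to the finite subcomplexes of the finitely
  many cells in \<open>bnd c\<close>.\<close>

lemma cell_in_finite_subcomplex:
  assumes "c \<in> C"
  shows "\<exists>D. finite D \<and> D \<subseteq> C \<and> c \<in> D \<and> (\<forall>d\<in>D. bnd d \<subseteq> D)"
  using assms
proof (induction "cdim c" arbitrary: c rule: less_induct)
  case less
  have "\<forall>d\<in>bnd c. \<exists>D. finite D \<and> D \<subseteq> C \<and> d \<in> D \<and> (\<forall>e\<in>D. bnd e \<subseteq> D)"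
    by (intro ballI less.hyps) (use bnd(2,3)[OF less.prems] in auto)
  then obtain F where F: "\<forall>d\<in>bnd c. finite (F d) \<and> F d \<subseteq> C \<and> d \<in> F d \<and> (\<forall>e\<in>F d. bnd e \<subseteq> F d)"
    by (rule bchoice[THEN exE])
  let ?D = "insert c (\<Union>d\<in>bnd c. F d)"
  have "finite ?D"
    using F bnd(1)[OF less(2)] by simp
  moreover have "?D \<subseteq> C" "bnd c \<subseteq> ?D" "\<forall>d\<in>(\<Union>d\<in>bnd c. F d). bnd d \<subseteq> ?D"
    using F less(2) by blast+
  ultimately show ?case
    by (intro exI[of _ ?D]) simp
qed

text \<open>Removing a cell of maximal dimension leaves a family closed under \<open>bnd\<close>,
  and \<open>lec_attach\<close> puts the cell back. The induction starts from the basepoint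
  alone.\<close>

lemma lec_finite_subcomplex:
  assumes "finite D" "D \<subseteq> C" "{y0} \<in> D" "cdim {y0} = 0" "\<And>d. d \<in> D \<Longrightarrow> bnd d \<subseteq> D"
  shows "compactin Y (\<Union>D) \<and> lec (subtopology Y (\<Union>D)) y0"
  using assms
proof (induction "card D" arbitrary: D rule: less_induct)
  case less
  show ?case
  proof (cases "D = {{y0}}")
    case True
    then have "y0 \<in> topspace Y"
      using less.prems(2) cover by auto
    then show ?thesis
      using True lec_singleton by simp
  next
    case False
    \<comment> \<open>The basepoint cell is never removed, since \<open>y0\<close> has to remain at
      every stage.\<close>
    let ?M = "D - {{y0}}"
    have "?M \<noteq> {}" "finite ?M"
      using False less.prems by auto
    then have "Max (cdim ` ?M) \<in> cdim ` ?M"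
      by (intro Max_in) auto
    then obtain c where c: "c \<in> ?M" "cdim c = Max (cdim ` ?M)"
      by (metis imageE)
    then have max: "cdim d \<le> cdim c" if "d \<in> ?M" for d
      using that \<open>finite ?M\<close> by simp
    have cC: "c \<in> C"
      using c less.prems(2) by blast
    let ?D = "D - {c}"
    have closed: "bnd d \<subseteq> ?D" if "d \<in> D" for d
    proof -
      \<comment> \<open>Cells of \<open>bnd d\<close> have smaller dimension than \<open>d\<close>:
        this contradicts maximality of \<open>c\<close>, and for \<open>d = {y0}\<close> it is
        impossible in dimension 0.\<close>
      have "c \<notin> bnd d"
        using bnd(3)[of d c] max[of d] that less.prems(2,4) by (cases "d = {y0}") auto
      then show ?thesis
        using less.prems(5)[OF that] by blast
    qed
    have "compactin Y (\<Union>?D) \<and> lec (subtopology Y (\<Union>?D)) y0"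
    proof (rule less.hyps)
      show "card ?D < card D"
        using c less.prems(1) by (intro card_Diff1_less) auto
      show "{y0} \<in> ?D"
        using c less.prems(3) by blast
    qed (use less.prems closed in auto)
    then have IH: "compactin Y (\<Union>?D)" "lec (subtopology Y (\<Union>?D)) y0"
      by auto
    obtain \<psi> where \<psi>: "homeomorphic_maps
        (subtopology (disc_top (cdim c)) (disc (cdim c) - disc_bd (cdim c))) (subtopology Y c) (\<Phi> c) \<psi>"
      using homeo[OF cC] homeomorphic_map_maps by blast
    interpret cell_attachment Y "\<Union>?D" y0 "cdim c" "\<Phi> c" c \<psi>
    proof
      show "y0 \<in> \<Union>?D"
        using less.prems(3) c by auto
      show "\<Phi> c ` disc_bd (cdim c) \<subseteq> \<Union>?D"
        using bnd(4)[OF cC] closed[of c] c(1) by (meson DiffD1 Union_mono order_trans)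
      show "c \<inter> \<Union>?D = {}"
        using same_cell[OF cC] less.prems(2) by blast
    qed (use Hausdorff IH cont[OF cC] cell_Y[OF cC] \<psi> in auto)
    have "L' = \<Union>D"
      using c(1) unfolding L'_def by blast
    then show ?thesis
      using compact_L' lec_attach[OF IH(2)] by simp
  qed
qed

end

lemma compact_in_lec:
  assumes "cellular Y y0" "compactin Y K"
  obtains L where "compactin Y L" "K \<subseteq> L" "y0 \<in> L" "lec (subtopology Y L) y0"
proof -
  obtain C cdim where cw: "cw_complex_with Y C cdim" and y0: "{y0} \<in> C" "cdim {y0} = 0"
    using assms(1) unfolding cellular_def by blast
  let ?P = "\<lambda>c \<Phi> D. continuous_map (disc_top (cdim c)) Y \<Phi> \<and>
        homeomorphic_map (subtopology (disc_top (cdim c)) (disc (cdim c) - disc_bd (cdim c)))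
                         (subtopology Y c) \<Phi> \<and>
        finite D \<and> D \<subseteq> C \<and> (\<forall>d\<in>D. cdim d < cdim c) \<and> \<Phi> ` disc_bd (cdim c) \<subseteq> \<Union>D"
  have "\<forall>c\<in>C. \<exists>\<Phi> D. ?P c \<Phi> D"
    using cw unfolding cw_complex_with_def by blast
  then obtain \<Phi> where "\<forall>c\<in>C. \<exists>D. ?P c (\<Phi> c) D"
    by (rule bchoice[THEN exE])
  then obtain bnd where *: "\<forall>c\<in>C. ?P c (\<Phi> c) (bnd c)"
    by (rule bchoice[THEN exE])
  interpret cw_chart Y C cdim \<Phi> bnd
  proof
    show "closedin Y A" if "A \<subseteq> topspace Y" "\<And>c. c \<in> C \<Longrightarrow> closedin Y (A \<inter> Y closure_of c)" for A
      using cw that unfolding cw_complex_with_def by simp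
    show "Hausdorff_space Y" "pairwise disjnt C" "\<Union>C = topspace Y"
      using cw unfolding cw_complex_with_def by simp_all
  qed (use * in auto)
  let ?M = "insert {y0} {c \<in> C. c \<inter> K \<noteq> {}}"
  have M: "finite ?M" "?M \<subseteq> C"
    using finite_cells_meeting_compact[OF assms(2)] y0 by auto
  then have "\<forall>c\<in>?M. \<exists>D. finite D \<and> D \<subseteq> C \<and> c \<in> D \<and> (\<forall>d\<in>D. bnd d \<subseteq> D)"
    using cell_in_finite_subcomplex by blast
  then obtain F where F: "\<forall>c\<in>?M. finite (F c) \<and> F c \<subseteq> C \<and> c \<in> F c \<and> (\<forall>d\<in>F c. bnd d \<subseteq> F c)"
    by (rule bchoice[THEN exE])
  define D where "D = (\<Union>c\<in>?M. F c)"
  have D: "finite D" "D \<subseteq> C" "{y0} \<in> D" "\<And>d. d \<in> D \<Longrightarrow> bnd d \<subseteq> D"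
    using M(1) F unfolding D_def by blast+
  have "K \<subseteq> \<Union>D"
  proof
    fix y assume "y \<in> K"
    moreover obtain c where "c \<in> C" "y \<in> c"
      using compactin_subset_topspace[OF assms(2)] \<open>y \<in> K\<close> cover by blast
    ultimately have "c \<in> ?M"
      by blast
    then show "y \<in> \<Union>D"
      using F \<open>y \<in> c\<close> unfolding D_def by blast
  qed
  then show thesis
    using that[of "\<Union>D"] lec_finite_subcomplex[OF D(1-3) y0(2) D(4)] D(3) by blast
qed

section \<open>Pushing along the graph of a map\<close>

text \<open>It suffices to deform points near the graph of \<open>h 0\<close>, since a Urysohn
  function stops the deformation further away. All three legs of the path are constant at
  \<open>(x0, y0)\<close>, so the basepoint is fixed for every elapsed time.\<close>

lemma lec_homotopy_extension:
  assumes X: "compact_space X" "Hausdorff_space X" and M: "compact_space M" "Hausdorff_space M"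
    and y0: "y0 \<in> topspace M" and "lec M y0"
    and h: "continuous_map (prod_topology (top_of_set {0..1::real}) X) M (\<lambda>(t, x). h t x)"
    and h_x0: "x0 \<in> topspace X" "\<And>t. t \<in> {0..1} \<Longrightarrow> h t x0 = y0"
  obtains \<Theta> where
    "continuous_map (prod_topology (prod_topology X M) euclideanreal) M (\<lambda>(p, t). \<Theta> p t)"
    "\<And>x y. x \<in> topspace X \<Longrightarrow> y \<in> topspace M \<Longrightarrow> \<Theta> (x, y) 0 = y"
    "\<And>x. x \<in> topspace X \<Longrightarrow> \<Theta> (x, h 0 x) 1 = h 1 x"
    "\<And>t. \<Theta> (x0, y0) t = y0"
proof -
  obtain \<alpha> \<beta> V where
    \<alpha>: "continuous_map (prod_topology (prod_topology M M) euclideanreal) M (\<lambda>(z, t). \<alpha> z t)" and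
    \<beta>: "continuous_map (prod_topology (prod_topology M M) euclideanreal) M (\<lambda>(z, t). \<beta> z t)" and
    0: "\<And>p q. p \<in> topspace M \<Longrightarrow> q \<in> topspace M \<Longrightarrow> \<alpha> (p, q) 0 = p"
      "\<And>p q. p \<in> topspace M \<Longrightarrow> q \<in> topspace M \<Longrightarrow> \<beta> (p, q) 0 = q" and
    diag: "\<And>p t. p \<in> topspace M \<Longrightarrow> \<alpha> (p, p) t = \<beta> (p, p) t" "\<And>t. \<alpha> (y0, y0) t = y0" and
    V: "openin (prod_topology M M) V" "\<And>p. p \<in> topspace M \<Longrightarrow> (p, p) \<in> V" "\<And>z. z \<in> V \<Longrightarrow> \<alpha> z 1 = \<beta> z 1"
    using \<open>lec M y0\<close> by (rule lecE) (use y0 in auto)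
  define b where "b = h 0"
  have b: "continuous_map X M b"
    using continuous_map_compose2[OF h, of X "\<lambda>_. 0" "\<lambda>x. x"] by (simp add: b_def)
  have b_M: "b x \<in> topspace M" if "x \<in> topspace X" for x
    using continuous_map_image_subset_topspace[OF b] that by auto
  \<comment> \<open>From \<open>y\<close> along \<open>\<alpha>\<close>, then back along \<open>\<beta>\<close> to \<open>b x\<close>, then along the given homotopy.\<close>
  define \<sigma> where "\<sigma> = (\<lambda>x y s. if s \<le> 1 then \<alpha> (y, b x) s else if s \<le> 2 then \<beta> (y, b x) (2 - s)
      else h (clamp01 (s - 2)) x)"
  \<comment> \<open>The legs \<alpha> and \<beta> are known to meet at \<open>s = 1\<close> only
    over \<open>V\<close>, hence the assumption \<open>inV\<close>.\<close>
  have \<sigma>: "continuous_map W M (\<lambda>w. \<sigma> (x w) (y w) (s w))"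
    if x: "continuous_map W X x" and y: "continuous_map W M y" and s: "continuous_map W euclideanreal s"
      and inV: "\<And>w. w \<in> topspace W \<Longrightarrow> (y w, b (x w)) \<in> V" for W :: "(('a \<times> 'b) \<times> real) topology" and x y s
  proof -
    have bx: "continuous_map W M (\<lambda>w. b (x w))"
      using continuous_map_compose[OF x b] by (simp add: o_def)
    have xX: "x w \<in> topspace X" and yM: "y w \<in> topspace M" if "w \<in> topspace W" for w
      using that continuous_map_image_subset_topspace[OF x] continuous_map_image_subset_topspace[OF y] by auto
    have \<beta>h: "continuous_map W M (\<lambda>w. if s w \<le> 2 then \<beta> (y w, b (x w)) (2 - s w) else h (clamp01 (s w - 2)) (x w))"
    proof (rule continuous_map_cases_le)
      have "continuous_map W M (\<lambda>w. \<beta> (y w, b (x w)) (2 - s w))"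
        by (intro continuous_map_compose2[OF \<beta>] continuous_map_pairedI y bx continuous_map_diff s) simp
      then show "continuous_map (subtopology W {w \<in> topspace W. s w \<le> 2}) M (\<lambda>w. \<beta> (y w, b (x w)) (2 - s w))"
        by (rule continuous_map_from_subtopology)
      have "continuous_map W (top_of_set {0..1}) (\<lambda>w. clamp01 (s w - 2))"
        by (intro continuous_map_into_subtopology continuous_map_clamp01 continuous_map_diff s) auto
      then have "continuous_map W M (\<lambda>w. h (clamp01 (s w - 2)) (x w))"
        using x by (rule continuous_map_compose2[OF h])
      then show "continuous_map (subtopology W {w \<in> topspace W. 2 \<le> s w}) M (\<lambda>w. h (clamp01 (s w - 2)) (x w))"
        by (rule continuous_map_from_subtopology)
      show "\<beta> (y w, b (x w)) (2 - s w) = h (clamp01 (s w - 2)) (x w)" if "w \<in> topspace W" "s w = 2" for w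
        using that 0(2)[OF yM b_M[OF xX]] by (simp add: b_def)
    qed (use s in auto)
    have "continuous_map W M (\<lambda>w. if s w \<le> 1 then \<alpha> (y w, b (x w)) (s w)
        else if s w \<le> 2 then \<beta> (y w, b (x w)) (2 - s w) else h (clamp01 (s w - 2)) (x w))"
    proof (rule continuous_map_cases_le)
      have "continuous_map W M (\<lambda>w. \<alpha> (y w, b (x w)) (s w))"
        by (intro continuous_map_compose2[OF \<alpha>] continuous_map_pairedI y bx s)
      then show "continuous_map (subtopology W {w \<in> topspace W. s w \<le> 1}) M (\<lambda>w. \<alpha> (y w, b (x w)) (s w))"
        by (rule continuous_map_from_subtopology)
      show "continuous_map (subtopology W {w \<in> topspace W. 1 \<le> s w}) M
          (\<lambda>w. if s w \<le> 2 then \<beta> (y w, b (x w)) (2 - s w) else h (clamp01 (s w - 2)) (x w))"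
        by (rule continuous_map_from_subtopology[OF \<beta>h])
    qed (use s inV V(3) in auto)
    then show ?thesis
      by (simp add: \<sigma>_def)
  qed
  define Q where "Q = prod_topology X M"
  define P where "P = prod_topology Q euclideanreal"
  define graph where "graph = {p \<in> topspace Q. snd p = b (fst p)}"
  define \<Omega> where "\<Omega> = {p \<in> topspace Q. (snd p, b (fst p)) \<in> V}"
  have fstQ: "continuous_map Q X fst" and sndQ: "continuous_map Q M snd"
    by (simp_all add: Q_def continuous_map_fst continuous_map_snd)
  have bQ: "continuous_map Q M (\<lambda>p. b (fst p))"
    using continuous_map_compose[OF fstQ b] by (simp add: o_def)
  have "normal_space Q"
    unfolding Q_def using X M
    by (intro compact_Hausdorff_or_regular_imp_normal_space)
      (auto simp: compact_space_prod_topology Hausdorff_space_prod_topology)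
  moreover have "closedin Q graph"
    unfolding graph_def by (rule closedin_continuous_maps_eq[OF M(2) sndQ bQ])
  moreover have "openin Q \<Omega>"
    unfolding \<Omega>_def
    by (rule openin_continuous_map_preimage[OF continuous_map_pairedI[OF sndQ bQ] V(1)])
  then have "closedin Q (topspace Q - \<Omega>)"
    by blast
  moreover have "disjnt graph (topspace Q - \<Omega>)"
    using V(2) b_M by (auto simp: disjnt_iff graph_def \<Omega>_def Q_def)
  ultimately obtain \<eta> :: "'a \<times> 'b \<Rightarrow> real" where \<eta>: "continuous_map Q euclideanreal \<eta>"
    and \<eta>_graph: "\<eta> ` graph \<subseteq> {1}" and \<eta>_\<Omega>: "\<eta> ` (topspace Q - \<Omega>) \<subseteq> {0}"
    by (rule Urysohn_lemma_alt)
  \<comment> \<open>The full path has length 3. The cutoff is 0 at \<open>\<eta> p = 1/2\<close>,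
    where \<sigma> still rests at \<open>y\<close>, and 1 on the graph. Wherever \<eta> is at least
    1/2, the point lies in \<Omega>, so \<sigma> is continuous.\<close>
  define \<Theta> where "\<Theta> = (\<lambda>p t. if 1/2 \<le> \<eta> p
      then \<sigma> (fst p) (snd p) (3 * clamp01 (2 * \<eta> p - 1) * clamp01 t) else snd p)"
  have onP: "continuous_map P N (\<lambda>q. k (fst q))" if "continuous_map Q N k" for N :: "'n topology" and k
    using continuous_map_compose[OF continuous_map_fst that] by (simp add: o_def P_def)
  have sndP: "continuous_map P euclideanreal snd"
    by (simp add: P_def continuous_map_snd)
  have in\<Omega>: "(snd p, b (fst p)) \<in> V" if "p \<in> topspace Q" "1/2 \<le> \<eta> p" for p
    using that \<eta>_\<Omega> by (auto simp: \<Omega>_def)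
  have \<sigma>_0: "\<sigma> x y 0 = y" if "x \<in> topspace X" "y \<in> topspace M" for x y
    using 0(1)[OF that(2) b_M[OF that(1)]] by (simp add: \<sigma>_def)
  have "continuous_map P M (\<lambda>q. if 1/2 \<le> \<eta> (fst q)
      then \<sigma> (fst (fst q)) (snd (fst q)) (3 * clamp01 (2 * \<eta> (fst q) - 1) * clamp01 (snd q)) else snd (fst q))"
  proof (rule continuous_map_cases_le)
    show "continuous_map (subtopology P {q \<in> topspace P. 1/2 \<le> \<eta> (fst q)}) M
      (\<lambda>q. \<sigma> (fst (fst q)) (snd (fst q)) (3 * clamp01 (2 * \<eta> (fst q) - 1) * clamp01 (snd q)))"
      by (intro \<sigma> continuous_map_from_subtopology onP[OF fstQ] onP[OF sndQ] continuous_map_real_mult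
          continuous_map_clamp01 continuous_map_diff onP[OF \<eta>] sndP)
        (use in\<Omega> in \<open>auto simp: P_def\<close>)
    show "\<sigma> (fst (fst q)) (snd (fst q)) (3 * clamp01 (2 * \<eta> (fst q) - 1) * clamp01 (snd q)) = snd (fst q)"
      if "q \<in> topspace P" "1/2 = \<eta> (fst q)" for q
      using that \<sigma>_0[of "fst (fst q)" "snd (fst q)"] by (auto simp: P_def Q_def that(2)[symmetric])
  qed (auto intro: onP \<eta> continuous_map_from_subtopology sndQ)
  then have "continuous_map P M (\<lambda>(p, t). \<Theta> p t)"
    by (simp add: \<Theta>_def case_prod_unfold)
  moreover have "\<Theta> (x, y) 0 = y" if "x \<in> topspace X" "y \<in> topspace M" for x y
    using \<sigma>_0[OF that] by (simp add: \<Theta>_def)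
  moreover have \<eta>_1: "\<eta> (x, b x) = 1" if "x \<in> topspace X" for x
  proof -
    have "(x, b x) \<in> graph"
      using that b_M by (simp add: graph_def Q_def)
    then show ?thesis
      using \<eta>_graph by blast
  qed
  then have "\<Theta> (x, h 0 x) 1 = h 1 x" if "x \<in> topspace X" for x
    using \<eta>_1[OF that] by (simp add: \<Theta>_def \<sigma>_def b_def)
  moreover have "\<Theta> (x0, y0) t = y0" for t
  proof -
    have bx0: "b x0 = y0"
      by (simp add: b_def h_x0)
    then have "\<sigma> x0 y0 s = y0" for s
      using diag(1)[OF y0] diag(2) h_x0(2)[of "clamp01 (s - 2)"] by (auto simp: \<sigma>_def)
    then show ?thesis
      by (simp add: \<Theta>_def)
  qed
  ultimately show thesis
    using that unfolding P_def Q_def by blast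
qed

section \<open>Invariance of strong similarity\<close>

lemma topspace_dsimplex_top [simp]: "topspace (dsimplex_top E) = dsimplex E"
  by (simp add: dsimplex_top_def)

lemma compact_space_dsimplex_top:
  assumes "finite E"
  shows "compact_space (dsimplex_top E)"
proof -
  let ?Q = "(\<Pi>\<^sub>E i\<in>UNIV. {0..1::real})"
  have coord: "continuous_map (powertop_real UNIV) euclideanreal (\<lambda>v. v i)" for i :: nat
    by (rule continuous_map_product_projection) simp
  have pos: "closedin (powertop_real UNIV) {v. 0 \<le> v i}" for i :: nat
    using closedin_continuous_map_preimage[OF coord, of "{0..}" i] by simp
  have zero: "closedin (powertop_real UNIV) {v. v i = 0}" for i :: nat
    using closedin_continuous_map_preimage[OF coord, of "{0}" i] by simp
  have "continuous_map (powertop_real UNIV) euclideanreal (\<lambda>v. sum v E)"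
    using assms by (intro continuous_map_sum coord)
  from closedin_continuous_map_preimage[OF this, of "{1}"]
  have one: "closedin (powertop_real UNIV) {v. sum v E = 1}"
    by simp
  have "closedin (powertop_real UNIV) (\<Inter>(range (\<lambda>i. {v. 0 \<le> v i}) \<union> (\<lambda>i. {v. v i = 0}) ` (- E)
      \<union> {{v. sum v E = 1}}))"
    using pos zero one by (intro closedin_Inter) auto
  moreover have "\<Inter>(range (\<lambda>i. {v. 0 \<le> v i}) \<union> (\<lambda>i. {v. v i = 0}) ` (- E) \<union> {{v. sum v E = 1}}) = dsimplex E"
    by (auto simp: dsimplex_def)
  ultimately have "closedin (powertop_real UNIV) (dsimplex E)"
    by simp
  moreover have "0 \<le> v i \<and> v i \<le> 1" if "v \<in> dsimplex E" for v i
  proof (cases "i \<in> E")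
    case True
    then have "v i \<le> sum v E"
      using that assms by (intro member_le_sum) (auto simp: dsimplex_def)
    then show ?thesis
      using that by (simp add: dsimplex_def)
  qed (use that in \<open>simp add: dsimplex_def\<close>)
  then have "dsimplex E \<subseteq> ?Q"
    by auto
  moreover have "compactin (powertop_real UNIV) ?Q"
    by (subst compactin_PiE) auto
  ultimately have "compactin (powertop_real UNIV) (dsimplex E)"
    using closed_compactin by blast
  then show ?thesis
    by (simp add: dsimplex_top_def compact_space_subtopology)
qed

lemma cellular_imp_Hausdorff_space: "cellular X x0 \<Longrightarrow> Hausdorff_space X"
  unfolding cellular_def cw_complex_with_def by (elim exE conjE)

lemma cellular_imp_basepoint:
  assumes "cellular X x0"
  shows "x0 \<in> topspace X"
proof -
  obtain C cdim where C: "cw_complex_with X C cdim" "{x0} \<in> C"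
    using assms unfolding cellular_def by blast
  have "\<Union>C = topspace X"
    using C(1) by (simp add: cw_complex_with_def)
  then show ?thesis
    using C(2) by blast
qed

theorem theorem6p1:
  fixes X :: "'x topology" and Y :: "'y topology" and x0 :: 'x and y0 :: 'y
    and r :: nat and a b a' b' :: "'x \<Rightarrow> 'y"
  assumes "cellular X x0" and "cellular Y y0" and "compact_space X"
    and "a \<in> based_maps X x0 Y y0" and "b \<in> based_maps X x0 Y y0"
    and "a' \<in> based_maps X x0 Y y0" and "b' \<in> based_maps X x0 Y y0"
    and "based_homotopic X x0 Y y0 a' a"
    and "strongly_similar X x0 Y y0 r a b"
    and "based_homotopic X x0 Y y0 b b'"
  shows "strongly_similar X x0 Y y0 r a' b'"
  unfolding strongly_similar_def
proof (intro allI impI)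
  fix E :: "nat set" assume E: "finite E \<and> E \<noteq> {}"
  note X = cellular_imp_Hausdorff_space[OF \<open>cellular X x0\<close>] cellular_imp_basepoint[OF \<open>cellular X x0\<close>]
  note Y = cellular_imp_Hausdorff_space[OF \<open>cellular Y y0\<close>] cellular_imp_basepoint[OF \<open>cellular Y y0\<close>]
  let ?co = "co_top X x0 Y y0" and ?U = "dsimplex_top E"
  let ?PC = "path_component_of_set ?co a"
  have "path_component_of ?co a' a"
    by (rule based_homotopic_imp_path_component_of[OF assms(8) X(2) assms(6,4)])
  then have PC: "path_component_of_set ?co a' = ?PC"
    by (simp add: path_component_of_equiv)
  obtain S where S: "S \<in> free_ab (umaps ?U (subtopology ?co ?PC))" and "fissile E S"
    and filt: "frag_of (restrict (\<lambda>_. b) (dsimplex E)) - S \<in> wr_filt ?U X x0 Y y0 (r + 1)"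
    using assms(9) E unfolding strongly_similar_def by blast
  have w: "continuous_map ?U ?co w" "\<And>u. u \<in> dsimplex E \<Longrightarrow> w u \<in> ?PC"
    if "w \<in> Poly_Mapping.keys S" for w
    using S that by (auto simp: free_ab_def umaps_def continuous_map_in_subtopology)
  have w_based: "w u \<in> based_maps X x0 Y y0"
    if "w \<in> Poly_Mapping.keys S" "u \<in> dsimplex E" for w u
    using w(2)[OF that] path_component_of_set_subset_co_top by fast
  have wX: "continuous_map (prod_topology ?U X) Y (\<lambda>(u, x). w u x)" if "w \<in> Poly_Mapping.keys S" for w
    using continuous_map_co_top_uncurry[OF \<open>compact_space X\<close> X(1) w(1)[OF that]] .
  obtain h where h: "continuous_map (prod_topology (top_of_set {0..1::real}) X) Y h"
    "\<And>x. h (0, x) = b x" "\<And>x. h (1, x) = b' x" "\<And>t. t \<in> {0..1} \<Longrightarrow> h (t, x0) = y0"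
    using assms(10) unfolding based_homotopic_def homotopic_with_def by auto

  \<comment> \<open>The values of the finitely many maps in \<open>S\<close> and of the homotopy
    from \<open>b\<close> to \<open>b'\<close> fill a compact set, which fits into one subspace
    \<open>L\<close>.\<close>
  define Kw :: "((nat \<Rightarrow> real) \<Rightarrow> 'x \<Rightarrow> 'y) \<Rightarrow> 'y set"
    where "Kw = (\<lambda>w. (\<lambda>(u, x). w u x) ` (dsimplex E \<times> topspace X))"
  define Kh where "Kh = h ` ({0..1} \<times> topspace X)"
  have "compact_space (prod_topology ?U X)" "compact_space (prod_topology (top_of_set {0..1::real}) X)"
    using \<open>compact_space X\<close> compact_space_dsimplex_top E
    by (auto simp: compact_space_prod_topology compact_space_subtopology)
  then have "compactin Y (Kw w)" if "w \<in> Poly_Mapping.keys S" for w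
    using image_compactin[OF _ wX[OF that]] by (simp add: Kw_def compact_space_def)
  moreover have "compactin Y Kh"
    using image_compactin[OF _ h(1)] \<open>compact_space (prod_topology (top_of_set {0..1::real}) X)\<close>
    by (simp add: Kh_def compact_space_def)
  ultimately have "compactin Y (\<Union>(insert Kh (Kw ` Poly_Mapping.keys S)))"
    by (intro compactin_Union) auto
  then obtain L where L: "compactin Y L" "\<Union>(insert Kh (Kw ` Poly_Mapping.keys S)) \<subseteq> L" "y0 \<in> L"
    and "lec (subtopology Y L) y0"
    using compact_in_lec[OF \<open>cellular Y y0\<close>] by metis
  let ?M = "subtopology Y L"
  have M: "compact_space ?M" "Hausdorff_space ?M" "y0 \<in> topspace ?M"
    using L Y by (auto simp: compact_space_subtopology Hausdorff_space_subtopology)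
  have hM: "continuous_map (prod_topology (top_of_set {0..1::real}) X) ?M (\<lambda>(t, x). h (t, x))"
    using h(1) L(2) by (auto simp: continuous_map_in_subtopology Kh_def)
  have wM: "continuous_map (prod_topology ?U X) ?M (\<lambda>(u, x). w u x)" if "w \<in> Poly_Mapping.keys S" for w
    using wX[OF that] L(2) that by (auto simp: continuous_map_in_subtopology Kw_def)
  obtain \<Theta> where \<Theta>: "continuous_map (prod_topology (prod_topology X ?M) euclideanreal) ?M (\<lambda>(p, t). \<Theta> p t)"
    and \<Theta>_0: "\<And>x y. x \<in> topspace X \<Longrightarrow> y \<in> topspace ?M \<Longrightarrow> \<Theta> (x, y) 0 = y"
    and \<Theta>_1: "\<And>x. x \<in> topspace X \<Longrightarrow> \<Theta> (x, h (0, x)) 1 = h (1, x)"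
    and \<Theta>_y0: "\<And>t. \<Theta> (x0, y0) t = y0"
    using lec_homotopy_extension[OF \<open>compact_space X\<close> X(1) M \<open>lec ?M y0\<close> hM X(2) h(4)] by blast
  \<comment> \<open>\<Theta> is controlled only over \<open>L\<close>; accordingly, continuity and
    preservation of the path component are shown below just for the keys of
    \<open>S\<close>.\<close>
  define \<tau> :: "('x \<Rightarrow> 'y) \<Rightarrow> 'x \<Rightarrow> 'y"
    where "\<tau> = (\<lambda>f. restrict (\<lambda>x. \<Theta> (x, f x) 1) (topspace X))"
  define \<phi> :: "((nat \<Rightarrow> real) \<Rightarrow> 'x \<Rightarrow> 'y) \<Rightarrow> (nat \<Rightarrow> real) \<Rightarrow> 'x \<Rightarrow> 'y"
    where "\<phi> = (\<lambda>w. restrict (\<lambda>u. \<tau> (w u)) (dsimplex E))"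

  have \<tau>_b: "\<tau> b = b'"
    using \<Theta>_1 h(2,3) assms(7) by (auto simp: \<tau>_def based_maps_def extensional_def fun_eq_iff)
  have \<phi>_cont: "continuous_map ?U ?co (\<phi> w)" if "w \<in> Poly_Mapping.keys S" for w
  proof -
    have "continuous_map (prod_topology ?U X) ?M (\<lambda>p. \<Theta> (snd p, (case p of (u, x) \<Rightarrow> w u x)) 1)"
      by (intro continuous_map_compose2[OF \<Theta>] continuous_map_pairedI continuous_map_snd wM that) simp
    then have "continuous_map (prod_topology ?U X) Y (\<lambda>(u, x). \<Theta> (x, w u x) 1)"
      by (auto simp: case_prod_unfold dest: continuous_map_into_fulltopology)
    then have "continuous_map ?U ?co (\<lambda>u. restrict (\<lambda>x. \<Theta> (x, w u x) 1) (topspace X))"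
      using w_based[OF that] \<Theta>_y0 X(2)
      by (intro continuous_map_co_top_curry) (auto simp: based_maps_def)
    then show ?thesis
      by (rule continuous_map_eq) (auto simp: \<phi>_def \<tau>_def)
  qed
  \<comment> \<open>Letting the time of \<Theta> run from 0 to 1 gives a based homotopy from
    \<open>w u\<close> to \<open>\<phi> w u\<close>.\<close>
  have \<phi>_PC: "\<phi> w u \<in> ?PC" if "w \<in> Poly_Mapping.keys S" "u \<in> dsimplex E" for w u
  proof -
    note wu = w_based[OF that]
    have "continuous_map X (prod_topology ?U X) (\<lambda>x. (u, x))"
      using that(2) by (intro continuous_map_pairedI) auto
    from continuous_map_compose[OF this wM[OF that(1)]]
    have wuM: "continuous_map X ?M (w u)"
      by (simp add: o_def)
    let ?I = "top_of_set {0..1::real}"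
    have "continuous_map (prod_topology ?I X) ?M (\<lambda>p. w u (snd p))"
      using continuous_map_compose[OF continuous_map_snd wuM] by (simp add: o_def)
    then have "continuous_map (prod_topology ?I X) ?M (\<lambda>p. \<Theta> (snd p, w u (snd p)) (fst p))"
      by (intro continuous_map_compose2[OF \<Theta>] continuous_map_pairedI continuous_map_snd
          continuous_map_into_fulltopology[OF continuous_map_fst])
    then have "continuous_map (prod_topology ?I X) Y (\<lambda>(t, x). \<Theta> (x, w u x) t)"
      by (auto simp: case_prod_unfold dest: continuous_map_into_fulltopology)
    then have "path_component_of ?co (restrict (\<lambda>x. \<Theta> (x, w u x) 0) (topspace X))
        (restrict (\<lambda>x. \<Theta> (x, w u x) 1) (topspace X))"
      using wu \<Theta>_y0 X(2) by (intro path_component_of_co_topI) (auto simp: based_maps_def)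
    moreover have "restrict (\<lambda>x. \<Theta> (x, w u x) 0) (topspace X) = w u"
      using \<Theta>_0 continuous_map_image_subset_topspace[OF wuM] wu
      by (fastforce simp: based_maps_def extensional_def fun_eq_iff)
    ultimately have "path_component_of ?co (w u) (\<phi> w u)"
      using that(2) by (simp add: \<phi>_def \<tau>_def)
    then show ?thesis
      using w(2)[OF that] path_component_of_trans by fastforce
  qed
  have keys: "Poly_Mapping.keys (lin \<phi> S) \<subseteq> \<phi> ` Poly_Mapping.keys S"
    by (rule keys_lin)
  have "\<phi> w \<in> umaps ?U (subtopology ?co ?PC)" if "w \<in> Poly_Mapping.keys S" for w
    using \<phi>_cont[OF that] \<phi>_PC[OF that]
    by (auto simp: umaps_def continuous_map_in_subtopology \<phi>_def)
  then have 1: "lin \<phi> S \<in> free_ab (umaps ?U (subtopology ?co (path_component_of_set ?co a')))"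
    using keys unfolding PC free_ab_def by blast
  have 2: "fissile E (lin \<phi> S)"
    unfolding \<phi>_def using E \<open>fissile E S\<close> by (intro fissile_postcompose) auto
  \<comment> \<open>Since \<tau> sends \<open>b\<close> to \<open>b'\<close>, the new difference is
    the pushforward of the old one, and \<open>filt_postcompose\<close> applies.\<close>
  have eq: "frag_of (restrict (\<lambda>_. b') (dsimplex E)) - lin \<phi> S
      = lin \<phi> (frag_of (restrict (\<lambda>_. b) (dsimplex E)) - S)"
    by (simp add: lin_diff \<phi>_def \<tau>_b cong: restrict_cong)
  have "lin (sharp y0) (lin \<phi> (frag_of (restrict (\<lambda>_. b) (dsimplex E)) - S))
      \<in> filt (wr_points (topspace ?U) X x0) None (r + 1)"
    unfolding \<phi>_def \<tau>_def using filt
    by (simp add: wr_filt_def filt_postcompose[where \<theta> = "\<lambda>x y. \<Theta> (x, y) 1"])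
  moreover have "restrict (\<lambda>_. b') (dsimplex E) \<in> umaps ?U ?co"
  proof -
    have "continuous_map ?U ?co (\<lambda>_. b')"
      using assms(7) by simp
    then show ?thesis
      unfolding umaps_def by (auto intro: continuous_map_eq)
  qed
  moreover have "\<phi> w \<in> umaps ?U ?co" if "w \<in> Poly_Mapping.keys S" for w
    using \<phi>_cont[OF that] by (auto simp: umaps_def \<phi>_def)
  then have "Poly_Mapping.keys (lin \<phi> S) \<subseteq> umaps ?U ?co"
    using keys by blast
  ultimately have 3: "frag_of (restrict (\<lambda>_. b') (dsimplex E)) - lin \<phi> S \<in> wr_filt ?U X x0 Y y0 (r + 1)"
    using keys_diff[of "frag_of (restrict (\<lambda>_. b') (dsimplex E))" "lin \<phi> S"]
    unfolding wr_filt_def free_ab_def eq[symmetric] by auto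
  show "\<exists>S. S \<in> free_ab (umaps ?U (subtopology ?co (path_component_of_set ?co a'))) \<and>
      fissile E S \<and> frag_of (restrict (\<lambda>_. b') (dsimplex E)) - S \<in> wr_filt ?U X x0 Y y0 (r + 1)"
    using 1 2 3 by blast
qed

end
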